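(* There exists $X\subseteq\mathbb R$ of cardinality $\operatorname{cf}(\mathfrak d)$ such that all finite powers of $\mathbb Q(X)$ have Menger's property, but $\mathbb Q(X)$ does not have the Hurewicz property.
   Context: For $X\subseteq\mathbb R$, $\mathbb Q(X)$ is the subfield of $\mathbb R$ generated by $\mathbb Q\cup X$. $\mathbb N^{\mathbb N}$ has the product topology, with $\mathbb N$ discrete. For $f,g\in\mathbb N^{\mathbb N}$, $f\le^*g$ means $f(n)\le g(n)$ for all but finitely many $n$. A set $D\subseteq\mathbb N^{\mathbb N}$ is dominating if for each $g\in\mathbb N^{\mathbb N}$ there is $f\in D$ with $g\le^*f$; $\mathfrak d$ is the minimal cardinality of a dominating set, and $\operatorname{cf}(\mathfrak d)$ is its cofinality. A space $Y$ has Menger's property if no continuous image of $Y$ in $\mathbb N^{\mathbb N}$ is dominating. $Y$ has the Hurewicz property if each continuous image of $Y$ in $\mathbb N^{\mathbb N}$ is bounded with respect to $\le^*$, i.e. there is $g\in\mathbb N^{\mathbb N}$ with $f\le^*g$ for all $f$ in the image. *)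

theory Defs
  imports "HOL-Analysis.Analysis" "HOL-Algebra.Algebraic_Closure_Type"
    "HOL-Algebra.Generated_Fields"
begin

unbundle cardinal_syntax

definition le_star :: "(nat \<Rightarrow> nat) \<Rightarrow> (nat \<Rightarrow> nat) \<Rightarrow> bool"  (infix \<open>\<le>\<^sup>*\<close> 50)
  where "f \<le>\<^sup>* g \<longleftrightarrow> finite {n. \<not> f n \<le> g n}"

definition dominating :: "(nat \<Rightarrow> nat) set \<Rightarrow> bool"
  where "dominating D \<longleftrightarrow> (\<forall>g. \<exists>f\<in>D. g \<le>\<^sup>* f)"

definition le_star_bounded :: "(nat \<Rightarrow> nat) set \<Rightarrow> bool"
  where "le_star_bounded B \<longleftrightarrow> (\<exists>g. \<forall>f\<in>B. f \<le>\<^sup>* g)"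

(* A cardinal is a well-order up to the relation =o of being order isomorphic, so
   "the" least cardinal of a family is a choice among isomorphic least members. *)
definition least_card :: "'a rel set \<Rightarrow> 'a rel"
  where "least_card R = (SOME r. r \<in> R \<and> (\<forall>r'\<in>R. r \<le>o r'))"

definition dominating_number :: "(nat \<Rightarrow> nat) rel"
  where "dominating_number = least_card {|D| | D. dominating D}"

(* The library predicate cofinal asks for a strictly larger element. This agrees with
   the usual notion when r has no greatest element, in particular for infinite
   cardinals. If r has a greatest element, no set is cofinal in this sense and the
   value is unspecified; dominating_number is infinite, see infinite_dominating. *)
definition cofinality :: "'a rel \<Rightarrow> 'a rel"
  where "cofinality r = least_card {|A| | A. A \<subseteq> Field r \<and> cofinal A r}"

definition baire_space :: "(nat \<Rightarrow> nat) topology"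
  where "baire_space = product_topology (\<lambda>_. discrete_topology UNIV) UNIV"

definition Menger_property :: "'a topology \<Rightarrow> bool"
  where "Menger_property Y \<longleftrightarrow>
    (\<forall>h. continuous_map Y baire_space h \<longrightarrow> \<not> dominating (h ` topspace Y))"

definition Hurewicz_property :: "'a topology \<Rightarrow> bool"
  where "Hurewicz_property Y \<longleftrightarrow>
    (\<forall>h. continuous_map Y baire_space h \<longrightarrow> le_star_bounded (h ` topspace Y))"

definition rat_adjoin :: "real set \<Rightarrow> real set"
  where "rat_adjoin S = generate_field ring_of_type_algebra (\<rat> \<union> S)"

definition finite_power :: "'a topology \<Rightarrow> nat \<Rightarrow> (nat \<Rightarrow> 'a) topology"
  where "finite_power Y k = product_topology (\<lambda>_. Y) {..<k}"

lemma least_card: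
  assumes "R \<noteq> {}" "\<And>r. r \<in> R \<Longrightarrow> Card_order r"
  shows "least_card R \<in> R" "\<And>r. r \<in> R \<Longrightarrow> least_card R \<le>o r"
proof -
  have "\<exists>r. r \<in> R \<and> (\<forall>r'\<in>R. r \<le>o r')"
    using exists_minim_Card_order[of R] assms by blast
  from someI_ex[OF this]
  show "least_card R \<in> R" "\<And>r. r \<in> R \<Longrightarrow> least_card R \<le>o r"
    unfolding least_card_def by blast+
qed

lemma dominating_UNIV: "dominating UNIV"
  unfolding dominating_def le_star_def by (metis (mono_tags) UNIV_I empty_Collect_eq finite.emptyI order_refl)

lemma dominating_number_attained: "\<exists>D. dominating D \<and> dominating_number = |D|"
proof -
  have "dominating_number \<in> {|D| | D. dominating D}"
    unfolding dominating_number_def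
    by (rule least_card(1)) (use dominating_UNIV in \<open>auto simp: card_of_Card_order\<close>)
  then show ?thesis by blast
qed

lemma dominating_number_le: "dominating D \<Longrightarrow> dominating_number \<le>o |D|"
  unfolding dominating_number_def by (rule least_card(2)) (auto simp: card_of_Card_order)

lemma Card_order_dominating_number: "Card_order dominating_number"
  using dominating_number_attained card_of_Card_order by metis

lemma infinite_dominating: 
  assumes "dominating D" shows "infinite D"
proof
  assume fin: "finite D"
  define g where "g n = Suc (\<Sum>f\<in>D. f n)" for n
  from assms obtain f where f: "f \<in> D" "g \<le>\<^sup>* f" unfolding dominating_def by blast
  have "\<not> g n \<le> f n" for n
    using member_le_sum[OF f(1), of "\<lambda>f. f n"] fin unfolding g_def by simp
  then show False using f(2) unfolding le_star_def by simp
qed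

lemma cofinal_Field_dominating_number: "cofinal (Field dominating_number) dominating_number"
proof -
  obtain D where D: "dominating D" "dominating_number = |D|"
    using dominating_number_attained by blast
  have "infinite (Field dominating_number)"
    using infinite_dominating[OF D(1)] D(2) Field_card_of by metis
  then show ?thesis
    unfolding cofinal_def using infinite_Card_order_limit[OF Card_order_dominating_number] by fast
qed

lemma cofinality_dominating_number:
  "\<exists>A. A \<subseteq> Field dominating_number \<and> cofinal A dominating_number
     \<and> cofinality dominating_number = |A|"
proof -
  have "cofinality dominating_number
      \<in> {|A| | A. A \<subseteq> Field dominating_number \<and> cofinal A dominating_number}"
    unfolding cofinality_def
    by (rule least_card(1))
      (use cofinal_Field_dominating_number in \<open>auto simp: card_of_Card_order\<close>)
  then show ?thesis by blast
qed

lemma cofinality_le: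
  "A \<subseteq> Field r \<Longrightarrow> cofinal A r \<Longrightarrow> cofinality r \<le>o |A|"
  unfolding cofinality_def by (rule least_card(2)) (auto simp: card_of_Card_order)

lemma baire_space_eq_euclidean: "baire_space = euclidean"
  unfolding baire_space_def by (metis euclidean_product_topology discrete_topology_unique
      topspace_euclidean open_discrete open_openin)

lemma rat_adjoin_eq_Inter:
  "rat_adjoin S = \<Inter>{K. subfield K ring_of_type_algebra \<and> \<rat> \<union> S \<subseteq> K}"
proof -
  interpret field "ring_of_type_algebra :: real ring" by (rule field_from_type_algebra)
  show ?thesis
    unfolding rat_adjoin_def
    by (rule generate_field_min_subfield2) (simp add: ring_of_type_algebra_def)
qed

end

theory Submission
  imports Defs
begin

text \<open>Let \<open>\<kappa>\<close> be the cofinality of \<open>\<dd>\<close>. A recursion of length \<open>\<kappa>\<close> yields a nontrivial filter \<open>F\<close> and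
  sets \<open>s i\<close> of natural numbers that are sparse with respect to \<open>F\<close>: for every function \<open>M\<close> and
  all large \<open>i\<close>, the set \<open>s i\<close> avoids the interval \<open>{p..<M p}\<close> for \<open>F\<close>-many \<open>p\<close>. Together with the finite
  sets they form a set \<open>Z\<close> all of whose finite powers have only \<open>F\<close>-bounded continuous images. A Cantor
  set of real numbers, parametrised by \<open>emb\<close>, is so independent that \<open>emb e\<close> is not in the field generated by
  the other \<open>emb z\<close>. Being a countable union of continuous images of finite powers of \<open>emb ` Z\<close>, the field
  generated by \<open>emb ` Z\<close> inherits the boundedness, hence Menger's property, in all finite powers. It is not Hurewicz if
  \<open>Z\<close> consists of coinfinite sets that approximate the cofinite sets closely enough, which are
  mapped outside the field. If all families smaller than \<open>\<dd>\<close> are bounded, then the sets \<open>s i\<close> can be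
  chosen with long full intervals. Otherwise an unbounded family provides such sets: if it is smaller than
  \<open>\<kappa>\<close>, adding it does no harm, and if \<open>\<kappa> < \<dd>\<close>, then Menger's property holds by cardinality alone.\<close>

section \<open>Subfields defined by rational approximation\<close>

text \<open>The filter is forced by the powers: to bound a function of several arguments at
  \<open>p\<close>, all of them must avoid \<open>{p..<M p}\<close> for the same \<open>p\<close>,
  which infinitely many \<open>p\<close> for each argument separately would not give. So each step
  of the recursion keeps all finite intersections of the earlier sets of such \<open>p\<close>
  infinite. The length cf(\<dd>) is right because a dominating family is an increasing union, up to
  finite maxima, of cf(\<dd>) pieces smaller than \<dd>. Each step then meets fewer than \<dd>
  requirements, and fewer than \<dd> functions do not dominate. Sparse sets approach finite sets,
  whereas failure of the Hurewicz property asks for sets approaching cofinite ones. The two demands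
  are compatible because the second concerns infinitely many \<open>p\<close>, not
  \<open>F\<close>-many. Whether one family can meet both depends on whether the bounding number
  equals \<dd>, hence the case distinction. Independence is needed because an unbounded function on
  the image of \<open>Z\<close> must extend continuously to the whole field: inverse distances to
  the numbers of cofinite sets do so if none of these numbers is generated.\<close>

definition fact_series :: "nat set \<Rightarrow> real"
  where "fact_series A = (\<Sum>m. if m \<in> A then 1 / 2 ^ fact m else 0)"

lemma fact_add_le: "1 \<le> m \<Longrightarrow> fact m + n \<le> (fact (n + m) :: nat)"
proof (induction n)
  case (Suc n)
  have "fact m + Suc n \<le> fact (n + m) + 1" using Suc by simp
  also have "\<dots> \<le> fact (n + m) + (n + m) * fact (n + m)"
    using Suc.prems by (simp add: Suc_le_eq)
  finally show ?case by (simp add: algebra_simps)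
qed simp

lemma summable_fact_series: "summable (\<lambda>m. if m \<in> A then 1 / 2 ^ fact m else (0::real))"
proof (rule summable_comparison_test')
  show "summable (\<lambda>m. (1/2::real) ^ m)" by (rule summable_geometric) simp
  show "norm (if m \<in> A then 1 / 2 ^ fact m else (0::real)) \<le> (1/2) ^ m" for m
    using fact_ge_self[of m] by (auto simp: power_one_over intro!: divide_left_mono power_increasing)
qed

lemma fact_series_tail:
  fixes A :: "nat set"
  assumes "1 \<le> m"
  defines "t \<equiv> fact_series A - (\<Sum>i<m. if i \<in> A then 1 / 2 ^ fact i else 0)"
  shows "0 \<le> t" "t \<le> 2 / 2 ^ fact m"
proof -
  let ?f = "\<lambda>i. if i \<in> A then 1 / 2 ^ fact i else (0::real)"
  have t: "t = (\<Sum>n. ?f (n + m))"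
    unfolding t_def fact_series_def
    using suminf_split_initial_segment[OF summable_fact_series, of A m] by simp
  have s: "summable (\<lambda>n. ?f (n + m))"
    using summable_fact_series[of A] by (rule summable_ignore_initial_segment)
  show "0 \<le> t" unfolding t by (rule suminf_nonneg[OF s]) auto
  have g: "(\<lambda>n. 1 / 2 ^ fact m * (1/2) ^ n) sums (1 / 2 ^ fact m * (1 / (1 - 1/2::real)))"
    by (intro sums_mult geometric_sums) simp
  have "?f (n + m) \<le> 1 / 2 ^ fact m * (1/2) ^ n" for n
  proof -
    have "(2::real) ^ (fact m + n) \<le> 2 ^ fact (n + m)"
      using fact_add_le[OF assms(1)] by (intro power_increasing) auto
    then have "1 / 2 ^ fact (n + m) \<le> 1 / (2::real) ^ (fact m + n)"
      by (intro divide_left_mono) auto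
    then show ?thesis by (auto simp: power_add power_one_over field_simps)
  qed
  then have "t \<le> (\<Sum>n. 1 / 2 ^ fact m * (1/2) ^ n)"
    unfolding t by (intro suminf_le s) (use g in \<open>auto simp: sums_iff\<close>)
  also have "\<dots> = 2 / 2 ^ fact m" using g by (simp add: sums_iff)
  finally show "t \<le> 2 / 2 ^ fact m" .
qed

lemma fact_series_head:
  "\<exists>u::int. (\<Sum>i<Suc m. if i \<in> A then 1 / 2 ^ fact i else 0) = real_of_int u / 2 ^ fact m"
proof -
  have "(1::real) / 2 ^ fact i = real_of_int (2 ^ (fact m - fact i)) / 2 ^ fact m" if "i < Suc m" for i
    using that fact_mono[of i m, where 'a = nat]
    by (simp add: field_simps flip: power_add)
  then have "(\<Sum>i<Suc m. if i \<in> A then 1 / 2 ^ fact i else 0)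
      = (\<Sum>i<Suc m. real_of_int (if i \<in> A then 2 ^ (fact m - fact i) else 0) / 2 ^ fact m)"
    by (intro sum.cong) auto
  also have "\<dots> = real_of_int (\<Sum>i<Suc m. if i \<in> A then 2 ^ (fact m - fact i) else 0) / 2 ^ fact m"
    unfolding of_int_sum by (rule sum_divide_distrib[symmetric])
  finally show ?thesis by blast
qed

text \<open>The numbers with rational approximations whose denominator is polynomial in the one of the
  partial sum of \<^term>\<open>fact_series E\<close> before an exponent \<^term>\<open>fact m\<close> with \<^term>\<open>m \<in> E\<close>, and
  whose error is of the order of the next exponent. The series itself is not among them: with such
  a denominator it is approximated best by that partial sum, whose error is at least \<open>1 / 2 ^ fact m\<close>.\<close>
definition liouville_field :: "nat set \<Rightarrow> real set"
  where "liouville_field E = {y. \<exists>D C. \<forall>\<^sub>F m in sequentially. m \<in> E \<longrightarrow>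
    (\<exists>u v::int. v \<noteq> 0 \<and> \<bar>real_of_int v\<bar> \<le> 2 ^ (D * fact (m - 1)) \<and>
       \<bar>y - real_of_int u / real_of_int v\<bar> \<le> C / 2 ^ fact (Suc m))}"

lemma liouville_fieldI:
  assumes "\<forall>\<^sub>F m in sequentially. m \<in> E \<longrightarrow>
    (\<exists>u v::int. v \<noteq> 0 \<and> \<bar>real_of_int v\<bar> \<le> 2 ^ (D * fact (m - 1)) \<and>
       \<bar>y - real_of_int u / real_of_int v\<bar> \<le> C / 2 ^ fact (Suc m))"
  shows "y \<in> liouville_field E"
  using assms unfolding liouville_field_def by blast

lemma liouville_fieldE:
  assumes "y \<in> liouville_field E"
  obtains D C where "0 < C" "\<forall>\<^sub>F m in sequentially. m \<in> E \<longrightarrow>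
    (\<exists>u v::int. v \<noteq> 0 \<and> \<bar>real_of_int v\<bar> \<le> 2 ^ (D * fact (m - 1)) \<and>
       \<bar>y - real_of_int u / real_of_int v\<bar> \<le> C / 2 ^ fact (Suc m))"
proof -
  obtain D C where *: "\<forall>\<^sub>F m in sequentially. m \<in> E \<longrightarrow>
    (\<exists>u v::int. v \<noteq> 0 \<and> \<bar>real_of_int v\<bar> \<le> 2 ^ (D * fact (m - 1)) \<and>
       \<bar>y - real_of_int u / real_of_int v\<bar> \<le> C / 2 ^ fact (Suc m))"
    using assms unfolding liouville_field_def by blast
  have le: "C / 2 ^ fact (Suc m) \<le> (\<bar>C\<bar> + 1) / 2 ^ fact (Suc m)" for m
    by (intro divide_right_mono) auto
  show ?thesis
    by (rule that[of "\<bar>C\<bar> + 1" D], simp, rule eventually_mono[OF *]) (use order_trans[OF _ le] in blast)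
qed

lemma rat_in_liouville_field: "x \<in> \<rat> \<Longrightarrow> x \<in> liouville_field E"
proof -
  assume "x \<in> \<rat>"
  then obtain u v :: int where uv: "v > 0" "x = u / v"
    by (metis Rats_cases')
  obtain D where D: "real_of_int v \<le> 2 ^ D"
    using real_arch_pow[of 2 "real_of_int v"] by (auto intro: less_imp_le)
  have "real_of_int v \<le> 2 ^ (D * fact (m - 1))" for m
    by (rule order_trans[OF D power_increasing]) auto
  then show ?thesis
    by (intro liouville_fieldI[of _ D _ 0] always_eventually allI impI exI[of _ u] exI[of _ v])
      (use uv in auto)
qed

lemma liouville_field_uminus: "x \<in> liouville_field E \<Longrightarrow> - x \<in> liouville_field E"
proof (erule liouville_fieldE)
  fix C D
  assume "\<forall>\<^sub>F m in sequentially. m \<in> E \<longrightarrow>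
    (\<exists>u v::int. v \<noteq> 0 \<and> \<bar>real_of_int v\<bar> \<le> 2 ^ (D * fact (m - 1)) \<and>
       \<bar>x - real_of_int u / real_of_int v\<bar> \<le> C / 2 ^ fact (Suc m))"
  then show "- x \<in> liouville_field E"
  proof (intro liouville_fieldI[of _ D _ C], elim eventually_mono, intro impI)
    fix m assume "m \<in> E \<longrightarrow> (\<exists>u v::int. v \<noteq> 0 \<and> \<bar>real_of_int v\<bar> \<le> 2 ^ (D * fact (m - 1)) \<and>
       \<bar>x - real_of_int u / real_of_int v\<bar> \<le> C / 2 ^ fact (Suc m))" "m \<in> E"
    then obtain u v :: int where "v \<noteq> 0" "\<bar>real_of_int v\<bar> \<le> 2 ^ (D * fact (m - 1))"
       "\<bar>x - real_of_int u / real_of_int v\<bar> \<le> C / 2 ^ fact (Suc m)" by blast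
    then show "\<exists>u v::int. v \<noteq> 0 \<and> \<bar>real_of_int v\<bar> \<le> 2 ^ (D * fact (m - 1)) \<and>
       \<bar>- x - real_of_int u / real_of_int v\<bar> \<le> C / 2 ^ fact (Suc m)"
      by (intro exI[of _ "- u"] exI[of _ v]) (auto simp: abs_minus_commute)
  qed
qed

text \<open>Shared by sum and product: denominators multiply, so the exponents \<open>D\<close> and
  \<open>D'\<close> add up, and the errors stay of the same order. The \<open>+ 1\<close> in
  \<open>L\<close> make one estimate fit both operations; for products it comes from x y - a b = x
  (y - b) + b (x - a).\<close>

lemma liouville_field_binop:
  fixes F :: "real \<Rightarrow> real \<Rightarrow> real"
  assumes "x \<in> liouville_field E" "y \<in> liouville_field E"
    and F: "\<And>u v u' v'::int. v \<noteq> 0 \<Longrightarrow> v' \<noteq> 0 \<Longrightarrow>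
      \<exists>w::int. F (real_of_int u / real_of_int v) (real_of_int u' / real_of_int v') = real_of_int w / real_of_int (v * v')"
    and L: "\<And>a b. \<bar>F x y - F a b\<bar> \<le> (\<bar>x\<bar> + 1) * \<bar>y - b\<bar> + (\<bar>b\<bar> + 1) * \<bar>x - a\<bar>"
  shows "F x y \<in> liouville_field E"
proof -
  from assms(1) obtain C D where C: "0 < C" and ev: "\<forall>\<^sub>F m in sequentially. m \<in> E \<longrightarrow>
    (\<exists>u v::int. v \<noteq> 0 \<and> \<bar>real_of_int v\<bar> \<le> 2 ^ (D * fact (m - 1)) \<and>
       \<bar>x - real_of_int u / real_of_int v\<bar> \<le> C / 2 ^ fact (Suc m))" by (rule liouville_fieldE)
  from assms(2) obtain C' D' where C': "0 < C'" and ev': "\<forall>\<^sub>F m in sequentially. m \<in> E \<longrightarrow>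
    (\<exists>u v::int. v \<noteq> 0 \<and> \<bar>real_of_int v\<bar> \<le> 2 ^ (D' * fact (m - 1)) \<and>
       \<bar>y - real_of_int u / real_of_int v\<bar> \<le> C' / 2 ^ fact (Suc m))" by (rule liouville_fieldE)
  show ?thesis
  proof (rule liouville_fieldI[of _ "D + D'" _ "(\<bar>x\<bar> + 1) * C' + (\<bar>y\<bar> + C' + 1) * C"],
      rule eventually_mono[OF eventually_conj[OF ev ev']], elim conjE, intro impI)
    fix m assume m: "m \<in> E" and 1: "m \<in> E \<longrightarrow> (\<exists>u v::int. v \<noteq> 0 \<and> \<bar>real_of_int v\<bar> \<le> 2 ^ (D * fact (m - 1)) \<and>
       \<bar>x - real_of_int u / real_of_int v\<bar> \<le> C / 2 ^ fact (Suc m))"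
      and 2: "m \<in> E \<longrightarrow> (\<exists>u v::int. v \<noteq> 0 \<and> \<bar>real_of_int v\<bar> \<le> 2 ^ (D' * fact (m - 1)) \<and>
       \<bar>y - real_of_int u / real_of_int v\<bar> \<le> C' / 2 ^ fact (Suc m))"
    let ?e = "1 / 2 ^ fact (Suc m) :: real"
    obtain u v :: int where uv: "v \<noteq> 0" "\<bar>real_of_int v\<bar> \<le> 2 ^ (D * fact (m - 1))"
       "\<bar>x - real_of_int u / real_of_int v\<bar> \<le> C * ?e" using 1 m by auto
    obtain u' v' :: int where uv': "v' \<noteq> 0" "\<bar>real_of_int v'\<bar> \<le> 2 ^ (D' * fact (m - 1))"
       "\<bar>y - real_of_int u' / real_of_int v'\<bar> \<le> C' * ?e" using 2 m by auto
    obtain w :: int where w: "F (real_of_int u / real_of_int v) (real_of_int u' / real_of_int v') = real_of_int w / real_of_int (v * v')"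
      using F uv(1) uv'(1) by blast
    let ?b = "real_of_int u' / real_of_int v'"
    have e: "?e \<le> 1" by simp
    have "\<bar>y - ?b\<bar> \<le> C'" using uv'(3) mult_left_mono[OF e, of C'] C' by linarith
    then have b: "\<bar>?b\<bar> + 1 \<le> \<bar>y\<bar> + C' + 1" by linarith
    have "\<bar>F x y - real_of_int w / real_of_int (v * v')\<bar>
        \<le> (\<bar>x\<bar> + 1) * \<bar>y - ?b\<bar> + (\<bar>?b\<bar> + 1) * \<bar>x - real_of_int u / real_of_int v\<bar>"
      unfolding w[symmetric] by (rule L)
    also have "\<dots> \<le> (\<bar>x\<bar> + 1) * (C' * ?e) + (\<bar>y\<bar> + C' + 1) * (C * ?e)"
      using uv(3) uv'(3) b C C' by (intro add_mono mult_mono) auto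
    also have "\<dots> = ((\<bar>x\<bar> + 1) * C' + (\<bar>y\<bar> + C' + 1) * C) / 2 ^ fact (Suc m)"
      by (simp add: add_divide_distrib)
    finally have 3: "\<bar>F x y - real_of_int w / real_of_int (v * v')\<bar> \<le> \<dots>" .
    have nz: "v * v' \<noteq> 0" using uv(1) uv'(1) by simp
    have "\<bar>real_of_int (v * v')\<bar> \<le> 2 ^ ((D + D') * fact (m - 1))"
      using mult_mono[OF uv(2) uv'(2)] by (simp add: abs_mult power_add algebra_simps)
    then show "\<exists>u v::int. v \<noteq> 0 \<and> \<bar>real_of_int v\<bar> \<le> 2 ^ ((D + D') * fact (m - 1)) \<and>
       \<bar>F x y - real_of_int u / real_of_int v\<bar>
         \<le> ((\<bar>x\<bar> + 1) * C' + (\<bar>y\<bar> + C' + 1) * C) / 2 ^ fact (Suc m)"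
      using nz 3 by blast
  qed
qed

lemma liouville_field_add:
  assumes "x \<in> liouville_field E" "y \<in> liouville_field E"
  shows "x + y \<in> liouville_field E"
proof (rule liouville_field_binop[OF assms, of "(+)"])
  fix u v u' v' :: int assume "v \<noteq> 0" "v' \<noteq> 0"
  then have "real_of_int u / real_of_int v + real_of_int u' / real_of_int v'
      = real_of_int (u * v' + u' * v) / real_of_int (v * v')" by (simp add: add_frac_eq)
  then show "\<exists>w::int. real_of_int u / real_of_int v + real_of_int u' / real_of_int v' = real_of_int w / real_of_int (v * v')"
    by blast
next
  fix a b :: real
  have "\<bar>x + y - (a + b)\<bar> \<le> 1 * \<bar>y - b\<bar> + 1 * \<bar>x - a\<bar>"
    using abs_triangle_ineq[of "x - a" "y - b"] by (simp add: algebra_simps)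
  also have "\<dots> \<le> (\<bar>x\<bar> + 1) * \<bar>y - b\<bar> + (\<bar>b\<bar> + 1) * \<bar>x - a\<bar>"
    by (intro add_mono mult_right_mono) auto
  finally show "\<bar>x + y - (a + b)\<bar> \<le> (\<bar>x\<bar> + 1) * \<bar>y - b\<bar> + (\<bar>b\<bar> + 1) * \<bar>x - a\<bar>" .
qed

lemma liouville_field_mult:
  assumes "x \<in> liouville_field E" "y \<in> liouville_field E"
  shows "x * y \<in> liouville_field E"
proof (rule liouville_field_binop[OF assms, of "(*)"])
  fix u v u' v' :: int
  have "real_of_int u / real_of_int v * (real_of_int u' / real_of_int v')
      = real_of_int (u * u') / real_of_int (v * v')" by simp
  then show "\<exists>w::int. real_of_int u / real_of_int v * (real_of_int u' / real_of_int v') = real_of_int w / real_of_int (v * v')"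
    by blast
next
  fix a b :: real
  have "x * y - a * b = x * (y - b) + b * (x - a)" by (simp add: algebra_simps)
  then have "\<bar>x * y - a * b\<bar> \<le> \<bar>x\<bar> * \<bar>y - b\<bar> + \<bar>b\<bar> * \<bar>x - a\<bar>"
    by (metis abs_mult abs_triangle_ineq)
  also have "\<dots> \<le> (\<bar>x\<bar> + 1) * \<bar>y - b\<bar> + (\<bar>b\<bar> + 1) * \<bar>x - a\<bar>"
    by (intro add_mono mult_right_mono) auto
  finally show "\<bar>x * y - a * b\<bar> \<le> (\<bar>x\<bar> + 1) * \<bar>y - b\<bar> + (\<bar>b\<bar> + 1) * \<bar>x - a\<bar>" .
qed

lemma inverse_fact_power_tendsto_0: "(\<lambda>m. C / 2 ^ fact (Suc m)) \<longlonglongrightarrow> (0::real)"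
proof (rule Lim_null_comparison)
  show "(\<lambda>m. \<bar>C\<bar> * (1/2) ^ m) \<longlonglongrightarrow> (0::real)"
    by (intro tendsto_mult_right_zero LIMSEQ_power_zero) simp
  have "m \<le> (fact (Suc m)::nat)" for m
    using fact_ge_self[of "Suc m"] by linarith
  then have "(2::real) ^ m \<le> 2 ^ fact (Suc m)" for m
    by (intro power_increasing) auto
  then show "\<forall>\<^sub>F m in sequentially. norm (C / 2 ^ fact (Suc m)) \<le> \<bar>C\<bar> * (1/2) ^ m"
    by (intro always_eventually allI) (auto simp: power_one_over intro!: divide_left_mono)
qed

text \<open>An approximation u/v of x turns into v/u. Once u/v is within |x|/2 of x, the new
  denominator is at most a constant times |v|, and u/v stays away from 0, which costs the factor 2
  in the error.\<close>

lemma liouville_field_inverse: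
  assumes "x \<in> liouville_field E"
  shows "inverse x \<in> liouville_field E"
proof (cases "x = 0")
  case True
  then show ?thesis using assms by simp
next
  case False
  from assms obtain C D where C: "0 < C" and ev: "\<forall>\<^sub>F m in sequentially. m \<in> E \<longrightarrow>
    (\<exists>u v::int. v \<noteq> 0 \<and> \<bar>real_of_int v\<bar> \<le> 2 ^ (D * fact (m - 1)) \<and>
       \<bar>x - real_of_int u / real_of_int v\<bar> \<le> C / 2 ^ fact (Suc m))" by (rule liouville_fieldE)
  have small: "\<forall>\<^sub>F m in sequentially. C / 2 ^ fact (Suc m) < \<bar>x\<bar> / 2"
    using order_tendstoD(2)[OF inverse_fact_power_tendsto_0, of "\<bar>x\<bar> / 2" C] False by simp
  obtain K where K: "\<bar>x\<bar> + \<bar>x\<bar> / 2 \<le> 2 ^ K"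
    using real_arch_pow[of 2 "\<bar>x\<bar> + \<bar>x\<bar> / 2"] by (auto intro: less_imp_le)
  show ?thesis
  proof (rule liouville_fieldI[of _ "K + D" _ "2 * C / x\<^sup>2"],
      rule eventually_mono[OF eventually_conj[OF ev small]], elim conjE, intro impI)
    fix m assume m: "m \<in> E" and 1: "m \<in> E \<longrightarrow> (\<exists>u v::int. v \<noteq> 0 \<and> \<bar>real_of_int v\<bar> \<le> 2 ^ (D * fact (m - 1)) \<and>
       \<bar>x - real_of_int u / real_of_int v\<bar> \<le> C / 2 ^ fact (Suc m))"
      and lt: "C / 2 ^ fact (Suc m) < \<bar>x\<bar> / 2"
    obtain u v :: int where uv: "v \<noteq> 0" "\<bar>real_of_int v\<bar> \<le> 2 ^ (D * fact (m - 1))"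
       "\<bar>x - real_of_int u / real_of_int v\<bar> \<le> C / 2 ^ fact (Suc m)" using 1 m by auto
    let ?q = "real_of_int u / real_of_int v"
    have q: "\<bar>?q\<bar> \<ge> \<bar>x\<bar> / 2" "\<bar>?q\<bar> \<le> \<bar>x\<bar> + \<bar>x\<bar> / 2" using uv(3) lt by linarith+
    then have q0: "?q \<noteq> 0" using False by auto
    then have u: "u \<noteq> 0" by auto
    have "\<bar>real_of_int u\<bar> = \<bar>?q\<bar> * \<bar>real_of_int v\<bar>" using uv(1) by (simp add: abs_divide)
    also have "\<dots> \<le> 2 ^ K * 2 ^ (D * fact (m - 1))"
      by (rule mult_mono[OF order_trans[OF q(2) K] uv(2)]) auto
    also have "\<dots> \<le> 2 ^ (K * fact (m - 1)) * 2 ^ (D * fact (m - 1))"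
      by (intro mult_right_mono power_increasing) auto
    finally have ub: "\<bar>real_of_int u\<bar> \<le> 2 ^ ((K + D) * fact (m - 1))"
      by (simp add: power_add algebra_simps)
    have "\<bar>inverse x - real_of_int v / real_of_int u\<bar> = \<bar>x - ?q\<bar> / (\<bar>x\<bar> * \<bar>?q\<bar>)"
    proof -
      have "inverse x - real_of_int v / real_of_int u = (?q - x) / (x * ?q)"
        using False q0 u uv(1) by (simp add: field_simps)
      then show ?thesis by (simp add: abs_mult abs_minus_commute)
    qed
    also have "\<dots> \<le> (C / 2 ^ fact (Suc m)) / (\<bar>x\<bar> * (\<bar>x\<bar> / 2))"
      using uv(3) q(1) False C by (intro frac_le mult_left_mono mult_pos_pos) auto
    also have "\<dots> = 2 * C / x\<^sup>2 / 2 ^ fact (Suc m)"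
      using False by (simp add: power2_eq_square field_simps flip: abs_mult)
    finally have "\<bar>inverse x - real_of_int v / real_of_int u\<bar> \<le> 2 * C / x\<^sup>2 / 2 ^ fact (Suc m)" .
    then show "\<exists>u v::int. v \<noteq> 0 \<and> \<bar>real_of_int v\<bar> \<le> 2 ^ ((K + D) * fact (m - 1)) \<and>
       \<bar>inverse x - real_of_int u / real_of_int v\<bar> \<le> 2 * C / x\<^sup>2 / 2 ^ fact (Suc m)"
      using u ub by blast
  qed
qed

text \<open>For large \<open>m \<in> E\<close> the exponent m! is missing from the series. Hence the
  partial sum before \<open>m\<close>, with denominator 2^((m-1)!), already has an error of the
  order of the exponent (m+1)!.\<close>

lemma fact_series_in_liouville_field:
  assumes "finite (A \<inter> E)"
  shows "fact_series A \<in> liouville_field E"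
proof -
  obtain N where N: "\<And>m. m \<in> A \<Longrightarrow> m \<in> E \<Longrightarrow> m < N"
    using assms by (metis IntI finite_nat_set_iff_bounded)
  show ?thesis
  proof (rule liouville_fieldI[of _ 1 _ 2], rule eventually_mono[OF eventually_ge_at_top[of "Suc N"]], intro impI)
    fix m assume m: "Suc N \<le> m" "m \<in> E"
    then have "m \<notin> A" using N[of m] by auto
    then have eq: "(\<Sum>i<Suc m. if i \<in> A then 1 / 2 ^ fact i else 0) = (\<Sum>i<m. if i \<in> A then 1 / 2 ^ fact i else (0::real))"
      by simp
    obtain u :: int where u: "(\<Sum>i<m. if i \<in> A then 1 / 2 ^ fact i else 0) = real_of_int u / 2 ^ fact (m - 1)"
      using fact_series_head[of A "m - 1"] m by auto
    show "\<exists>u v::int. v \<noteq> 0 \<and> \<bar>real_of_int v\<bar> \<le> 2 ^ (1 * fact (m - 1)) \<and>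
       \<bar>fact_series A - real_of_int u / real_of_int v\<bar> \<le> 2 / 2 ^ fact (Suc m)"
      using fact_series_tail[of "Suc m" A] eq u
      by (intro exI[of _ u] exI[of _ "2 ^ fact (m - 1)"]) auto
  qed
qed

lemma fact_series_notin_liouville_field:
  assumes "infinite E"
  shows "fact_series E \<notin> liouville_field E"
proof
  assume "fact_series E \<in> liouville_field E"
  then obtain C D where C: "0 < C" and ev: "\<forall>\<^sub>F m in sequentially. m \<in> E \<longrightarrow>
    (\<exists>u v::int. v \<noteq> 0 \<and> \<bar>real_of_int v\<bar> \<le> 2 ^ (D * fact (m - 1)) \<and>
       \<bar>fact_series E - real_of_int u / real_of_int v\<bar> \<le> C / 2 ^ fact (Suc m))" by (rule liouville_fieldE)
  obtain K where K: "C \<le> 2 ^ K"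
    using real_arch_pow[of 2 C] by (auto intro: less_imp_le)
  from ev obtain N where N: "\<And>m. N \<le> m \<Longrightarrow> m \<in> E \<Longrightarrow>
    \<exists>u v::int. v \<noteq> 0 \<and> \<bar>real_of_int v\<bar> \<le> 2 ^ (D * fact (m - 1)) \<and>
       \<bar>fact_series E - real_of_int u / real_of_int v\<bar> \<le> C / 2 ^ fact (Suc m)"
    unfolding eventually_sequentially by blast
  \<comment> \<open>The share K + 1 makes the error C / 2^((m+1)!) at most half of 1 / 2^(m!). The
    share D + 3 contradicts m! = m (m-1)! at the end.\<close>
  obtain m where m: "m \<in> E" "N + D + K + 4 \<le> m"
    using assms by (meson infinite_nat_iff_unbounded_le)
  let ?y = "fact_series E" and ?a = "fact (m - 1) :: nat"
  obtain u v :: int where uv: "v \<noteq> 0" "\<bar>real_of_int v\<bar> \<le> 2 ^ (D * ?a)"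
       "\<bar>?y - real_of_int u / real_of_int v\<bar> \<le> C / 2 ^ fact (Suc m)"
    using N[of m] m by auto
  obtain w :: int where w: "(\<Sum>i<m. if i \<in> E then 1 / 2 ^ fact i else 0) = real_of_int w / 2 ^ ?a"
    using fact_series_head[of E "m - 1"] m by auto
  let ?s = "real_of_int w / 2 ^ ?a"
  have "?y - (\<Sum>i<Suc m. if i \<in> E then 1 / 2 ^ fact i else 0) \<ge> 0"
    using fact_series_tail(1)[of "Suc m" E] by simp
  then have lower: "1 / 2 ^ fact m \<le> ?y - ?s" using m(1) w by simp
  have upper: "?y - ?s \<le> 2 / 2 ^ fact m"
    using fact_series_tail(2)[of m E] w m by simp
  have fm: "fact m = m * ?a" using m(2) by (simp add: fact_reduce)
  have a1: "1 \<le> ?a" by simp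
  have big: "K + 1 + fact m \<le> (fact (Suc m) :: nat)"
  proof -
    have "K + 1 \<le> m * 1" using m(2) by simp
    also have "\<dots> \<le> m * fact m" by (intro mult_left_mono) auto
    finally show ?thesis by simp
  qed
  have "C / 2 ^ fact (Suc m) \<le> 2 ^ K / 2 ^ (K + 1 + fact m)"
    using K big by (intro frac_le power_increasing) auto
  also have "\<dots> = 1 / 2 / 2 ^ fact m" by (simp add: power_add)
  finally have err: "C / 2 ^ fact (Suc m) \<le> 1 / 2 / 2 ^ fact m" .
  \<comment> \<open>Two rationals that are distinct but at most 3 / 2^(m!) apart, although their
    common denominator is at most 2^((D+1) (m-1)!).\<close>
  define z where "z = real_of_int u / real_of_int v - ?s"
  have pos: "(0::real) < 1 / 2 ^ fact m" by simp
  have z: "0 < z" "z \<le> 3 * (1 / 2 ^ fact m)"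
    unfolding z_def using lower upper pos order_trans[OF uv(3) err] by linarith+
  have "z = real_of_int (u * 2 ^ ?a - w * v) / (real_of_int v * 2 ^ ?a)"
    unfolding z_def using uv(1) by (simp add: field_simps)
  moreover from this have "u * 2 ^ ?a - w * v \<noteq> 0" using z(1) by (metis div_0 of_int_0 less_irrefl)
  then have "1 \<le> \<bar>real_of_int (u * 2 ^ ?a - w * v)\<bar>" by linarith
  ultimately have "1 / (\<bar>real_of_int v\<bar> * 2 ^ ?a) \<le> \<bar>z\<bar>"
    by (auto simp: abs_mult intro!: divide_right_mono)
  moreover have "1 / (2 ^ (D * ?a) * 2 ^ ?a) \<le> 1 / (\<bar>real_of_int v\<bar> * 2 ^ ?a)"
    using uv(1,2) by (intro divide_left_mono mult_right_mono) auto
  ultimately have "1 / 2 ^ (D * ?a + ?a) \<le> z" using z(1) by (simp add: power_add)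
  also have "z < 4 * (1 / 2 ^ fact m)" using z(2) pos by linarith
  finally have "2 ^ fact m < (4::real) * 2 ^ (D * ?a + ?a)"
    by (simp add: field_simps)
  also have "\<dots> = 2 ^ (2 + (D * ?a + ?a))" by (simp only: power_add) simp
  finally have "fact m < 2 + (D * ?a + ?a)"
    by (rule power_less_imp_less_exp[of "2::real", rotated]) simp
  also have "\<dots> \<le> (D + 3) * ?a" using a1 by (simp add: algebra_simps)
  also have "\<dots> \<le> m * ?a" using m(2) by (intro mult_right_mono) auto
  finally show False using fm by simp
qed

section \<open>A Cantor set of independent numbers\<close>

text \<open>A branch of the binary tree, as the set of codes of its nodes. Recording the length
  \<open>n\<close> keeps the branch infinite even when \<open>s\<close> is finite.\<close>

definition branch :: "nat set \<Rightarrow> nat set"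
  where "branch s = range (\<lambda>n. prod_encode (n, set_encode (s \<inter> {..<n})))"

lemma infinite_branch: "infinite (branch s)"
  unfolding branch_def by (rule range_inj_infinite) (auto simp: inj_on_def)

lemma finite_branch_Int:
  assumes "s \<noteq> t"
  shows "finite (branch s \<inter> branch t)"
proof -
  obtain k where k: "k \<in> s \<longleftrightarrow> k \<notin> t" using assms by blast
  have "branch s \<inter> branch t \<subseteq> (\<lambda>n. prod_encode (n, set_encode (s \<inter> {..<n}))) ` {..k}"
  proof
    fix m assume "m \<in> branch s \<inter> branch t"
    then obtain n where n: "m = prod_encode (n, set_encode (s \<inter> {..<n}))"
      "set_encode (s \<inter> {..<n}) = set_encode (t \<inter> {..<n})"
      unfolding branch_def by auto
    then have "s \<inter> {..<n} = t \<inter> {..<n}" by (simp add: set_encode_eq)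
    then have "n \<le> k" using k by (metis IntD1 IntI lessThan_iff not_le)
    then show "m \<in> (\<lambda>n. prod_encode (n, set_encode (s \<inter> {..<n}))) ` {..k}" using n(1) by blast
  qed
  then show ?thesis by (rule finite_subset) simp
qed

text \<open>A code is at least the length of the segment that it encodes, so the codes up to
  \<open>n\<close> depend only on the set below \<open>n\<close>. This makes \<open>emb\<close>
  continuous.\<close>

lemma branch_cong:
  assumes "s \<inter> {..<n} = t \<inter> {..<n}" "m \<le> n" "m \<in> branch s"
  shows "m \<in> branch t"
proof -
  obtain k where k: "m = prod_encode (k, set_encode (s \<inter> {..<k}))"
    using assms(3) unfolding branch_def by auto
  then have "k \<le> n" using le_prod_encode_1[of k] assms(2) by (metis le_trans)
  then have "r \<inter> {..<k} = r \<inter> {..<n} \<inter> {..<k}" for r :: "nat set" by auto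
  then have "s \<inter> {..<k} = t \<inter> {..<k}" using assms(1) by metis
  then show ?thesis using k unfolding branch_def by auto
qed

text \<open>As distinct sets have almost disjoint branches, the values of \<^term>\<open>emb\<close> are independent.\<close>
definition emb :: "nat set \<Rightarrow> real"
  where "emb s = fact_series (branch s)"

lemma emb_dist:
  assumes "s \<inter> {..<n} = t \<inter> {..<n}"
  shows "\<bar>emb s - emb t\<bar> \<le> 2 / 2 ^ n"
proof -
  have "(\<Sum>i<Suc n. if i \<in> branch s then 1 / 2 ^ fact i else 0)
      = (\<Sum>i<Suc n. if i \<in> branch t then 1 / 2 ^ fact i else (0::real))"
    using branch_cong[OF assms] branch_cong[OF assms[symmetric]] by (intro sum.cong) auto
  then have "\<bar>emb s - emb t\<bar> \<le> 2 / 2 ^ fact (Suc n)"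
    using fact_series_tail[of "Suc n" "branch s"] fact_series_tail[of "Suc n" "branch t"]
    unfolding emb_def abs_le_iff by linarith
  also have "\<dots> \<le> 2 / 2 ^ n"
    using fact_ge_self[of "Suc n"] by (intro divide_left_mono power_increasing) auto
  finally show ?thesis .
qed

lemma emb_in_liouville_field: "s \<noteq> t \<Longrightarrow> emb t \<in> liouville_field (branch s)"
  unfolding emb_def by (intro fact_series_in_liouville_field finite_branch_Int) simp

lemma emb_notin_liouville_field: "emb s \<notin> liouville_field (branch s)"
  unfolding emb_def by (rule fact_series_notin_liouville_field[OF infinite_branch])

lemma inj_emb: "inj emb"
  by (metis injI emb_in_liouville_field emb_notin_liouville_field)

section \<open>The subfield of the real numbers generated by a set\<close>

lemma inv_ring_of_type_algebra:
  "x \<noteq> 0 \<Longrightarrow> inv\<^bsub>ring_of_type_algebra\<^esub> x = inverse (x::real)"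
proof -
  assume x: "x \<noteq> 0"
  interpret field "ring_of_type_algebra :: real ring" by (rule field_from_type_algebra)
  show ?thesis
    by (rule comm_inv_char) (use x in \<open>auto simp: ring_of_type_algebra_def\<close>)
qed

lemma a_inv_ring_of_type_algebra: "\<ominus>\<^bsub>ring_of_type_algebra\<^esub> x = - (x::real)"
proof -
  interpret field "ring_of_type_algebra :: real ring" by (rule field_from_type_algebra)
  show ?thesis
    by (rule minus_equality) (auto simp: ring_of_type_algebra_def)
qed

lemma rat_adjoin_minimal:
  assumes "\<rat> \<subseteq> K" "S \<subseteq> K"
    and "\<And>x y. x \<in> K \<Longrightarrow> y \<in> K \<Longrightarrow> x + y \<in> K"
    and "\<And>x y. x \<in> K \<Longrightarrow> y \<in> K \<Longrightarrow> x * y \<in> K"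
    and "\<And>x. x \<in> K \<Longrightarrow> - x \<in> K"
    and "\<And>x. x \<in> K \<Longrightarrow> inverse x \<in> K"
  shows "rat_adjoin S \<subseteq> K"
proof -
  interpret field "ring_of_type_algebra :: real ring" by (rule field_from_type_algebra)
  have "subfield K ring_of_type_algebra"
  proof (rule subfieldI'[OF subringI])
    show "\<one>\<^bsub>ring_of_type_algebra\<^esub> \<in> K"
      using assms(1) Rats_1 by (auto simp: ring_of_type_algebra_def)
  next
    fix x assume "x \<in> K - {\<zero>\<^bsub>ring_of_type_algebra\<^esub>}"
    then show "inv\<^bsub>ring_of_type_algebra\<^esub> x \<in> K"
      using assms(6) inv_ring_of_type_algebra[of x] by (auto simp: ring_of_type_algebra_def)
  qed (use assms in \<open>auto simp: a_inv_ring_of_type_algebra, auto simp: ring_of_type_algebra_def\<close>)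
  then show ?thesis unfolding rat_adjoin_eq_Inter using assms by blast
qed

lemma subfield_rat_adjoin: "subfield (rat_adjoin S) ring_of_type_algebra"
proof -
  interpret field "ring_of_type_algebra :: real ring" by (rule field_from_type_algebra)
  show ?thesis unfolding rat_adjoin_def
    by (rule generate_field_is_subfield) (simp add: ring_of_type_algebra_def)
qed

lemma rat_adjoin_closed:
  shows "x \<in> rat_adjoin S \<Longrightarrow> y \<in> rat_adjoin S \<Longrightarrow> x + y \<in> rat_adjoin S"
    and "x \<in> rat_adjoin S \<Longrightarrow> y \<in> rat_adjoin S \<Longrightarrow> x * y \<in> rat_adjoin S"
    and "x \<in> rat_adjoin S \<Longrightarrow> inverse x \<in> rat_adjoin S"
    and "x \<in> \<rat> \<Longrightarrow> x \<in> rat_adjoin S"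
    and "x \<in> S \<Longrightarrow> x \<in> rat_adjoin S"
proof -
  interpret field "ring_of_type_algebra :: real ring" by (rule field_from_type_algebra)
  note sub = subringE[OF subfieldE(1)[OF subfield_rat_adjoin[of S]]]
  show "x \<in> rat_adjoin S \<Longrightarrow> y \<in> rat_adjoin S \<Longrightarrow> x + y \<in> rat_adjoin S"
    using sub(7)[of x y] by (simp add: ring_of_type_algebra_def)
  show "x \<in> rat_adjoin S \<Longrightarrow> y \<in> rat_adjoin S \<Longrightarrow> x * y \<in> rat_adjoin S"
    using sub(6)[of x y] by (simp add: ring_of_type_algebra_def)
  show "x \<in> rat_adjoin S \<Longrightarrow> inverse x \<in> rat_adjoin S"
    using subfield_m_inv(1)[OF subfield_rat_adjoin[of S], of x] inv_ring_of_type_algebra[of x]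
    by (cases "x = 0") (auto simp: ring_of_type_algebra_def)
  show "x \<in> \<rat> \<Longrightarrow> x \<in> rat_adjoin S" "x \<in> S \<Longrightarrow> x \<in> rat_adjoin S"
    unfolding rat_adjoin_def by (auto intro: generate_field.incl)
qed

lemma emb_notin_rat_adjoin:
  assumes "s \<notin> T"
  shows "emb s \<notin> rat_adjoin (emb ` T)"
proof -
  have sub: "emb ` T \<subseteq> liouville_field (branch s)"
    using assms by (auto intro!: emb_in_liouville_field)
  have "rat_adjoin (emb ` T) \<subseteq> liouville_field (branch s)"
    by (rule rat_adjoin_minimal[OF subsetI[OF rat_in_liouville_field] sub])
      (assumption | rule liouville_field_add liouville_field_mult liouville_field_uminus
        liouville_field_inverse)+
  then show ?thesis using emb_notin_liouville_field by blast
qed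

section \<open>Smallness of finite powers of generated fields\<close>

text \<open>Sequences of countable open covers replace maps into the Baire space, as in Menger's
  selection principle. The least index need not be continuous, but near a point it cannot exceed its
  value there, which is the semicontinuity that \<open>filter_bounded_power\<close> assumes.\<close>

definition cover_small :: "((nat \<Rightarrow> nat) set \<Rightarrow> bool) \<Rightarrow> 'a topology \<Rightarrow> bool"
  where "cover_small Sm Y \<longleftrightarrow>
    (\<forall>U. (\<forall>n j::nat. openin Y (U n j)) \<and> (\<forall>n. topspace Y \<subseteq> (\<Union>j. U n j)) \<longrightarrow>
      Sm ((\<lambda>y n. LEAST j. y \<in> U n j) ` topspace Y))"

lemma cover_small_Menger:
  assumes "cover_small Sm Y" "\<And>A. Sm A \<Longrightarrow> \<not> dominating A"
  shows "Menger_property Y"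
  unfolding Menger_property_def
proof (intro allI impI)
  fix h assume h: "continuous_map Y baire_space h"
  define U where "U n j = {y \<in> topspace Y. h y n \<in> {j}}" for n j :: nat
  have "continuous_map Y (discrete_topology UNIV) (\<lambda>y. h y n)" for n
    using h unfolding baire_space_def continuous_map_componentwise_UNIV by blast
  then have "openin Y (U n j)" for n j
    unfolding U_def by (rule openin_continuous_map_preimage) simp
  moreover have "topspace Y \<subseteq> (\<Union>j. U n j)" for n unfolding U_def by auto
  ultimately have "Sm ((\<lambda>y n. LEAST j. y \<in> U n j) ` topspace Y)"
    using assms(1) unfolding cover_small_def by blast
  moreover have "(\<lambda>n. LEAST j. y \<in> U n j) = h y" if "y \<in> topspace Y" for y
    using that unfolding U_def by (auto simp: Least_equality)
  ultimately have "Sm (h ` topspace Y)" by simp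
  then show "\<not> dominating (h ` topspace Y)" by (rule assms(2))
qed

text \<open>Covers of \<open>Y\<close> are pulled back along each \<open>f i\<close>; the least
  index at a point \<open>x\<close> is then that of \<open>f i x\<close>, so the index functions
  over \<open>Y\<close> form a countable union of small sets.\<close>

lemma cover_small_Union_images:
  assumes Sm: "\<And>\<A>. countable \<A> \<Longrightarrow> (\<And>A. A \<in> \<A> \<Longrightarrow> Sm A) \<Longrightarrow> Sm (\<Union>\<A>)"
    and "countable J"
    and small: "\<And>i. i \<in> J \<Longrightarrow> cover_small Sm (T i)"
    and cont: "\<And>i. i \<in> J \<Longrightarrow> continuous_map (T i) Y (f i)"
    and onto: "topspace Y \<subseteq> (\<Union>i\<in>J. f i ` topspace (T i))"
  shows "cover_small Sm Y"
  unfolding cover_small_def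
proof (intro allI impI, elim conjE)
  fix U :: "nat \<Rightarrow> nat \<Rightarrow> _" assume U: "\<forall>n j. openin Y (U n j)" "\<forall>n. topspace Y \<subseteq> (\<Union>j. U n j)"
  define V where "V i n j = {x \<in> topspace (T i). f i x \<in> U n j}" for i n j
  let ?h = "\<lambda>y n. LEAST j. y \<in> U n j" and ?g = "\<lambda>i x n. LEAST j. x \<in> V i n j"
  have sub: "f i x \<in> topspace Y" if "i \<in> J" "x \<in> topspace (T i)" for i x
    using continuous_map_image_subset_topspace[OF cont[OF that(1)]] that(2) by blast
  have "Sm (?g i ` topspace (T i))" if "i \<in> J" for i
  proof -
    have "openin (T i) (V i n j)" for n j
      unfolding V_def using cont[OF that] U(1) by (blast intro: openin_continuous_map_preimage)
    moreover have "topspace (T i) \<subseteq> (\<Union>j. V i n j)" for n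
      unfolding V_def using sub[OF that] U(2) by blast
    ultimately show ?thesis using small[OF that] unfolding cover_small_def by blast
  qed
  then have "Sm (\<Union>((\<lambda>i. ?g i ` topspace (T i)) ` J))"
    by (intro Sm) (use \<open>countable J\<close> in auto)
  moreover have "\<Union>((\<lambda>i. ?g i ` topspace (T i)) ` J) = ?h ` topspace Y"
  proof -
    have "?g i ` topspace (T i) = ?h ` f i ` topspace (T i)" for i
      unfolding image_image by (rule image_cong) (simp_all add: V_def)
    then have "\<Union>((\<lambda>i. ?g i ` topspace (T i)) ` J) = ?h ` (\<Union>i\<in>J. f i ` topspace (T i))"
      by (simp only: image_UN)
    also have "(\<Union>i\<in>J. f i ` topspace (T i)) = topspace Y"
      using onto sub by (intro equalityI UN_least image_subsetI) simp_all
    finally show ?thesis .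
  qed
  ultimately show "Sm (?h ` topspace Y)" by simp
qed

text \<open>The inverse is replaced by continuous approximations. At each point of a field all of them
  take values in the field and almost all of them agree with the inverse, which is \<^term>\<open>0\<close>
  at \<^term>\<open>0\<close>.\<close>
datatype 'v rterm = Var 'v | Const rat | Add "'v rterm" "'v rterm" | Mult "'v rterm" "'v rterm"
  | Inv nat "'v rterm"

instance rterm :: (countable) countable
  by countable_datatype

primrec reval :: "'v rterm \<Rightarrow> ('v \<Rightarrow> real) \<Rightarrow> real" where
  "reval (Var v) x = x v"
| "reval (Const q) x = of_rat q"
| "reval (Add s t) x = reval s x + reval t x"
| "reval (Mult s t) x = reval s x * reval t x"
| "reval (Inv n t) x = reval t x / max ((reval t x)\<^sup>2) (1 / real (Suc n))"

lemma reval_map: "reval (map_rterm f t) x = reval t (x \<circ> f)"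
  by (induction t) auto

lemma reval_cong: "(\<And>v. v \<in> set_rterm t \<Longrightarrow> x v = y v) \<Longrightarrow> reval t x = reval t y"
  by (induction t) auto

lemma finite_set_rterm: "finite (set_rterm t)"
  by (induction t) auto

lemma reval_Inv_eq_inverse: "\<exists>n. reval (Inv n t) x = inverse (reval t x)"
proof (cases "reval t x = 0")
  case False
  then obtain n where "inverse (real (Suc n)) < (reval t x)\<^sup>2"
    using reals_Archimedean[of "(reval t x)\<^sup>2"] by auto
  then have "reval (Inv n t) x = reval t x / (reval t x)\<^sup>2"
    by (simp add: max_def inverse_eq_divide)
  then show ?thesis using False
    by (intro exI[of _ n]) (simp add: power2_eq_square divide_simps)
qed auto

lemma reval_in_rat_adjoin:
  "(\<And>v. v \<in> set_rterm t \<Longrightarrow> x v \<in> S) \<Longrightarrow> reval t x \<in> rat_adjoin S"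
proof (induction t)
  case (Inv n t)
  then have t: "reval t x \<in> rat_adjoin S" by simp
  have "1 / real (Suc n) \<in> rat_adjoin S"
    by (intro rat_adjoin_closed(4) Rats_divide Rats_1 Rats_of_nat)
  \<comment> \<open>The maximum is one of its two arguments, and both are in the field.\<close>
  then have "max ((reval t x)\<^sup>2) (1 / real (Suc n)) \<in> rat_adjoin S"
    unfolding max_def power2_eq_square
    using rat_adjoin_closed(2)[OF t t] by simp
  with t show ?case by (auto simp: divide_inverse intro!: rat_adjoin_closed(2,3))
qed (auto intro: rat_adjoin_closed)

text \<open>Valuations are infinite sequences so that two terms can be given disjoint variables:
  \<open>join\<close> interleaves their valuations along the even and odd indices.\<close>

lemma rat_adjoin_eq_reval:
  assumes "S \<noteq> {}"
  shows "rat_adjoin S = {reval t x | (t :: nat rterm) x. range x \<subseteq> S}"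
proof
  let ?K = "{reval t x | (t :: nat rterm) x. range x \<subseteq> S}"
  obtain s where s: "s \<in> S" using assms by blast
  have join: "\<exists>z t u. range z \<subseteq> S \<and> a = reval (t :: nat rterm) z \<and> b = reval u z"
    if "a \<in> ?K" "b \<in> ?K" for a b
  proof -
    from that obtain t u :: "nat rterm" and x y
      where xy: "range x \<subseteq> S" "range y \<subseteq> S" "a = reval t x" "b = reval u y" by blast
    define z where "z j = (if even j then x (j div 2) else y (j div 2))" for j
    have "range z \<subseteq> S" using xy(1,2) unfolding z_def by auto
    moreover have "a = reval (map_rterm (\<lambda>j. 2 * j) t) z"
      "b = reval (map_rterm (\<lambda>j. Suc (2 * j)) u) z"
      unfolding xy(3,4) reval_map z_def by (simp_all add: comp_def)
    ultimately show ?thesis by blast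
  qed
  show "rat_adjoin S \<subseteq> ?K"
  proof (rule rat_adjoin_minimal)
    show "\<rat> \<subseteq> ?K"
    proof
      fix x :: real assume "x \<in> \<rat>"
      then obtain q where "x = of_rat q" by (auto elim: Rats_cases)
      then have "x = reval (Const q) (\<lambda>_::nat. s)" by simp
      then show "x \<in> ?K" using s by blast
    qed
    show "S \<subseteq> ?K"
    proof
      fix x assume "x \<in> S"
      then have "x = reval (Var 0) (\<lambda>_::nat. x)" "range (\<lambda>_::nat. x) \<subseteq> S" by auto
      then show "x \<in> ?K" by blast
    qed
  next
    fix a b assume "a \<in> ?K" "b \<in> ?K"
    from join[OF this] obtain z and t u :: "nat rterm"
      where z: "range z \<subseteq> S" "a = reval t z" "b = reval u z" by blast
    have "a + b = reval (Add t u) z" "a * b = reval (Mult t u) z" using z by auto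
    then show "a + b \<in> ?K" "a * b \<in> ?K" using z(1) by blast+
  next
    fix a assume "a \<in> ?K"
    then obtain z and t :: "nat rterm" where z: "range z \<subseteq> S" "a = reval t z" by blast
    have "- a = reval (Mult (Const (-1)) t) z" using z(2) by simp
    then show "- a \<in> ?K" using z(1) by blast
    obtain n where "inverse a = reval (Inv n t) z" using reval_Inv_eq_inverse z(2) by metis
    then show "inverse a \<in> ?K" using z(1) by blast
  qed
  show "?K \<subseteq> rat_adjoin S"
  proof
    fix a assume "a \<in> ?K"
    then obtain z and t :: "nat rterm" where z: "range z \<subseteq> S" "a = reval t z" by blast
    show "a \<in> rat_adjoin S"
      unfolding z(2) by (rule reval_in_rat_adjoin) (use z(1) in blast)
  qed
qed

lemma topspace_finite_power: "topspace (finite_power (top_of_set S) k) = PiE {..<k} (\<lambda>_. S)"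
  unfolding finite_power_def by simp

lemma continuous_map_reval:
  "continuous_map (finite_power (top_of_set S) m) euclideanreal (reval t)"
proof (induction t)
  case (Var i)
  show ?case
  proof (cases "i < m")
    case True
    have "continuous_map (finite_power (top_of_set S) m) (top_of_set S) (\<lambda>x. x i)"
      unfolding finite_power_def by (rule continuous_map_product_projection) (use True in simp)
    then show ?thesis by (simp add: continuous_map_in_subtopology)
  next
    case False
    \<comment> \<open>Points of the power are extensional, so a variable outside the index set
      evaluates to a constant.\<close>
    then have undef: "undefined = x i" if "x \<in> topspace (finite_power (top_of_set S) m)" for x
      using that by (auto simp: topspace_finite_power PiE_def extensional_def)
    have "continuous_map (finite_power (top_of_set S) m) euclideanreal (\<lambda>_. undefined)" by simp
    then have "continuous_map (finite_power (top_of_set S) m) euclideanreal (\<lambda>x. x i)"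
      by (rule continuous_map_eq) (rule undef)
    then show ?thesis by simp
  qed
next
  case (Inv n t)
  have "max ((reval t x)\<^sup>2) (1 / real (Suc n)) \<noteq> 0" for x
    using less_le_trans[OF _ max.cobounded2, of 0 "1 / real (Suc n)" "(reval t x)\<^sup>2"] by simp
  then have "continuous_map (finite_power (top_of_set S) m) euclideanreal
      (\<lambda>x. reval t x / max ((reval t x)\<^sup>2) (1 / real (Suc n)))"
    by (intro continuous_map_real_divide continuous_map_real_max continuous_map_real_pow Inv) simp_all
  then show ?case by simp
qed (auto intro: continuous_map_add continuous_map_real_mult)

lemma cover_small_rat_adjoin:
  fixes S :: "real set"
  assumes Sm: "\<And>\<A>. countable \<A> \<Longrightarrow> (\<And>A. A \<in> \<A> \<Longrightarrow> Sm A) \<Longrightarrow> Sm (\<Union>\<A>)"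
    and S: "S \<noteq> {}" "\<And>m. cover_small Sm (finite_power (top_of_set S) m)"
  shows "cover_small Sm (finite_power (top_of_set (rat_adjoin S)) k)"
proof -
  let ?J = "{(ts :: nat rterm list, m :: nat). length ts = k \<and> (\<forall>t\<in>set ts. set_rterm t \<subseteq> {..<m})}"
  let ?f = "\<lambda>(ts, m) x. restrict (\<lambda>i. reval (ts ! i) x) {..<k}"
  have cont: "continuous_map (finite_power (top_of_set S) (snd p)) (finite_power (top_of_set (rat_adjoin S)) k) (?f p)"
    if J: "p \<in> ?J" for p
  proof -
    obtain ts m where p: "p = (ts, m)" "length ts = k" "\<And>t. t \<in> set ts \<Longrightarrow> set_rterm t \<subseteq> {..<m}"
      using J by (cases p) auto
    have "reval (ts ! i) x \<in> rat_adjoin S" if "i < k" "x \<in> PiE {..<m} (\<lambda>_. S)" for i x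
    proof (rule reval_in_rat_adjoin)
      fix v assume "v \<in> set_rterm (ts ! i)"
      then have "v < m" using p(3)[of "ts ! i"] p(2) that(1) by auto
      then show "x v \<in> S" using that(2) by auto
    qed
    then have "continuous_map (finite_power (top_of_set S) m) (top_of_set (rat_adjoin S)) (reval (ts ! i))"
      if "i < k" for i
      using that unfolding continuous_map_in_subtopology topspace_finite_power
      by (simp add: continuous_map_reval image_subset_iff)
    then have "continuous_map (finite_power (top_of_set S) m) (top_of_set (rat_adjoin S))
        (\<lambda>x. restrict (\<lambda>i. reval (ts ! i) x) {..<k} i)" if "i < k" for i
      using that by simp
    then show ?thesis
      unfolding p(1) finite_power_def[of "top_of_set (rat_adjoin S)"] continuous_map_componentwise
      by (simp add: image_subset_iff)
  qed
  have onto: "topspace (finite_power (top_of_set (rat_adjoin S)) k)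
      \<subseteq> (\<Union>p\<in>?J. ?f p ` topspace (finite_power (top_of_set S) (snd p)))"
  proof
    fix y assume "y \<in> topspace (finite_power (top_of_set (rat_adjoin S)) k)"
    then have y: "y \<in> PiE {..<k} (\<lambda>_. rat_adjoin S)" by (simp add: topspace_finite_power)
    have "\<exists>(t :: nat rterm) x. range x \<subseteq> S \<and> (i < k \<longrightarrow> y i = reval t x)" for i
    proof (cases "i < k")
      case True
      then have "y i \<in> rat_adjoin S" using y by auto
      then show ?thesis unfolding rat_adjoin_eq_reval[OF S(1)] by blast
    next
      case False
      obtain s where "s \<in> S" using S(1) by blast
      then show ?thesis using False by (intro exI[of _ "Var 0"] exI[of _ "\<lambda>_. s"]) auto
    qed
    then obtain t :: "nat \<Rightarrow> nat rterm" and x where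
      x: "\<And>i. range (x i) \<subseteq> S" and t: "\<And>i. i < k \<Longrightarrow> y i = reval (t i) (x i)" by metis
    \<comment> \<open>The pairing function gives each of the \<open>k\<close> coordinates its own
      variables, so a single valuation serves all terms. Only finitely many variables occur, and a
      finite power suffices.\<close>
    define z where "z v = x (fst (prod_decode v)) (snd (prod_decode v))" for v
    define u where "u i = map_rterm (\<lambda>j. prod_encode (i, j)) (t i)" for i
    have u: "reval (u i) z = reval (t i) (x i)" for i
      unfolding u_def z_def by (simp add: reval_map comp_def)
    have "finite (\<Union>i<k. set_rterm (u i))" using finite_set_rterm by blast
    then obtain m where m: "(\<Union>i<k. set_rterm (u i)) \<subseteq> {..<m}"
      using finite_nat_iff_bounded by blast
    let ?ts = "map u [0..<k]"
    have less_m: "v < m" if "i < k" "v \<in> set_rterm (u i)" for v i using m that by blast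
    then have J: "(?ts, m) \<in> ?J" by auto
    have Z: "restrict z {..<m} \<in> topspace (finite_power (top_of_set S) m)"
      using x unfolding topspace_finite_power z_def by auto
    have "y = ?f (?ts, m) (restrict z {..<m})"
    proof
      fix i
      show "y i = ?f (?ts, m) (restrict z {..<m}) i"
      proof (cases "i < k")
        case True
        have "reval (u i) (restrict z {..<m}) = reval (u i) z"
          by (rule reval_cong) (use less_m[OF True] in simp)
        then show ?thesis using True t u by simp
      next
        case False
        then show ?thesis using y by (auto simp: PiE_def extensional_def)
      qed
    qed
    then have "y \<in> ?f (?ts, m) ` topspace (finite_power (top_of_set S) (snd (?ts, m)))"
      unfolding snd_conv using Z by (rule image_eqI)
    then show "y \<in> (\<Union>p\<in>?J. ?f p ` topspace (finite_power (top_of_set S) (snd p)))"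
      by (rule UN_I[OF J])
  qed
  show ?thesis
  proof (rule cover_small_Union_images[where Sm = Sm and J = ?J and f = ?f
        and T = "\<lambda>p. finite_power (top_of_set S) (snd p)"])
    show "Sm (\<Union>\<A>)" if "countable \<A>" "\<And>A. A \<in> \<A> \<Longrightarrow> Sm A" for \<A> using that by (rule Sm)
    show "countable ?J" by (rule countableI_type)
    show "cover_small Sm (finite_power (top_of_set S) (snd p))" for p :: "nat rterm list \<times> nat" by (rule S(2))
    show "continuous_map (finite_power (top_of_set S) (snd p)) (finite_power (top_of_set (rat_adjoin S)) k) (?f p)"
      if "p \<in> ?J" for p
      using that by (rule cont)
    show "topspace (finite_power (top_of_set (rat_adjoin S)) k)
      \<subseteq> (\<Union>p\<in>?J. ?f p ` topspace (finite_power (top_of_set S) (snd p)))"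
      by (rule onto)
  qed
qed

section \<open>Cardinal arithmetic below the dominating number\<close>

lemma infinite_Field_dominating_number: "infinite (Field dominating_number)"
  using dominating_number_attained infinite_dominating Field_card_of by metis

lemma ordLess_not_dominating: "|A| <o dominating_number \<Longrightarrow> \<not> dominating A"
  using dominating_number_le not_ordLess_ordLeq by blast

lemma countable_le_star_bounded:
  assumes "countable A"
  shows "le_star_bounded A"
proof (cases "A = {}")
  case False
  define g where "g n = (\<Sum>i\<le>n. from_nat_into A i n)" for n
  have "f \<le>\<^sup>* g" if "f \<in> A" for f
  proof -
    obtain i where i: "f = from_nat_into A i"
      using from_nat_into_surj[OF assms \<open>f \<in> A\<close>] by metis
    have "f n \<le> g n" if "i \<le> n" for n
      unfolding g_def i using that by (intro member_le_sum) auto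
    then have "{n. \<not> f n \<le> g n} \<subseteq> {..<i}" by (auto simp: not_le[symmetric])
    then show ?thesis unfolding le_star_def by (rule finite_subset) simp
  qed
  then show ?thesis unfolding le_star_bounded_def by blast
qed (simp add: le_star_bounded_def)

lemma le_star_trans: "f \<le>\<^sup>* g \<Longrightarrow> g \<le>\<^sup>* h \<Longrightarrow> f \<le>\<^sup>* h"
  unfolding le_star_def
  by (rule finite_subset[of _ "{n. \<not> f n \<le> g n} \<union> {n. \<not> g n \<le> h n}"]) auto

lemma not_Suc_le_star: "\<not> (\<lambda>n. Suc (f n)) \<le>\<^sup>* f"
  unfolding le_star_def by simp

lemma dominating_not_le_star_bounded: "dominating A \<Longrightarrow> \<not> le_star_bounded A"
  unfolding dominating_def le_star_bounded_def by (meson le_star_trans not_Suc_le_star)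

lemma card_of_nat_ordLess_dominating_number: "|UNIV :: nat set| <o dominating_number"
proof (rule ccontr)
  assume "\<not> ?thesis"
  moreover obtain D where D: "dominating D" "dominating_number = |D|"
    using dominating_number_attained by blast
  ultimately have "|D| \<le>o |UNIV :: nat set|"
    using not_ordLess_iff_ordLeq[OF card_of_Well_order card_of_Well_order, of "UNIV :: nat set" D] by simp
  then have "countable D"
    by (metis card_of_ordLeq countable_def)
  then show False
    using D(1) countable_le_star_bounded dominating_not_le_star_bounded by blast
qed

lemma card_of_finite_ordLess_Field:
  assumes "Card_order r" "infinite (Field r)" "finite A"
  shows "|A| <o r"
  by (rule finite_ordLess_infinite[OF card_of_Well_order])
    (use assms in \<open>auto simp: Field_card_of card_order_on_def\<close>)

lemma card_of_Times_ordLess_Field: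
  assumes r: "Card_order r" "infinite (Field r)" and "|A| <o r" "|B| <o r"
  shows "|A \<times> B| <o r"
proof (cases "finite (A <+> B)")
  case True
  then have "finite (A \<times> B)" by simp
  then show ?thesis
    by (rule card_of_finite_ordLess_Field[OF r])
next
  case False
  have "|A \<times> B| \<le>o |A <+> B|"
    using False card_of_Sigma_ordLeq_infinite[OF False card_of_Plus1, of "\<lambda>_. B"] card_of_Plus2 by blast
  also have "|A <+> B| <o r"
    using assms by (intro card_of_Plus_ordLess_infinite_Field) auto
  finally show ?thesis .
qed

lemma countable_ordLeq:
  assumes "countable A" "Card_order r" "infinite (Field r)"
  shows "|A| \<le>o r"
proof -
  have "|A| \<le>o |UNIV :: nat set|"
    using assms(1) unfolding countable_def card_of_ordLeq[symmetric] by auto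
  also have "|UNIV :: nat set| \<le>o |Field r|" using assms(3) by (simp add: infinite_iff_card_of_nat)
  also have "|Field r| =o r" using assms(2) by (rule card_of_Field_ordIso)
  finally show ?thesis .
qed

lemma card_of_lists_ordLeq:
  assumes r: "Card_order r" "infinite (Field r)" and "|A| \<le>o r"
  shows "|lists A| \<le>o r"
proof -
  have *: "|{xs \<in> lists A. length xs = n}| \<le>o r" for n
  proof (induction n)
    case 0
    have "finite {xs \<in> lists A. length xs = 0}" by (rule finite_subset[of _ "{[]}"]) auto
    then show ?case by (intro ordLess_imp_ordLeq card_of_finite_ordLess_Field r)
  next
    case (Suc n)
    let ?L = "{xs \<in> lists A. length xs = n}"
    have "{xs \<in> lists A. length xs = Suc n} \<subseteq> (\<lambda>(x, xs). x # xs) ` (A \<times> ?L)"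
      by (auto simp: length_Suc_conv image_iff)
    then have "|{xs \<in> lists A. length xs = Suc n}| \<le>o |A \<times> ?L|"
      by (meson card_of_image card_of_mono1 ordLeq_transitive)
    also have "|A \<times> ?L| \<le>o r"
      using assms Suc by (intro card_of_Times_ordLeq_infinite_Field) auto
    finally show ?case .
  qed
  have "|UNIV :: nat set| \<le>o r" by (rule countable_ordLeq) (use r in simp_all)
  then have "|\<Union>n. {xs \<in> lists A. length xs = n}| \<le>o r"
    using * r by (intro card_of_UNION_ordLeq_infinite_Field) auto
  moreover have "(\<Union>n. {xs \<in> lists A. length xs = n}) = lists A" by auto
  ultimately show ?thesis by simp
qed

lemma card_of_finite_subsets_ordLess:
  assumes "|A| <o dominating_number"
  shows "|{T. finite T \<and> T \<subseteq> A}| <o dominating_number"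
proof -
  \<comment> \<open>Adding the natural numbers makes the set infinite, as the bound on lists
    requires, and keeps it below \<dd>, which is uncountable.\<close>
  let ?C = "A <+> (UNIV :: nat set)"
  have "{T. finite T \<and> T \<subseteq> A} \<subseteq> set ` lists A"
    by (auto simp: image_iff lists_eq_set dest: finite_list)
  then have "|{T. finite T \<and> T \<subseteq> A}| \<le>o |lists A|"
    by (meson card_of_image card_of_mono1 ordLeq_transitive)
  also have "|lists A| \<le>o |?C|"
    by (intro card_of_lists_ordLeq card_of_Card_order card_of_Plus1) (simp add: Field_card_of)
  also have "|?C| <o dominating_number"
    using assms card_of_nat_ordLess_dominating_number infinite_Field_dominating_number
      Card_order_dominating_number
    by (intro card_of_Plus_ordLess_infinite_Field) auto
  finally show ?thesis .
qed

section \<open>Sets with many gaps\<close>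

text \<open>Dually, \<^term>\<open>gaps (- s) M\<close> is the set of all \<^term>\<open>p\<close> such that \<^term>\<open>{p..<M p} \<subseteq> s\<close>.\<close>
definition gaps :: "nat set \<Rightarrow> (nat \<Rightarrow> nat) \<Rightarrow> nat set"
  where "gaps s M = {p. s \<inter> {p..<M p} = {}}"

lemma gaps_mono: "p \<in> gaps s M' \<Longrightarrow> M p \<le> M' p \<Longrightarrow> p \<in> gaps s M"
  unfolding gaps_def by fastforce

lemma infinite_gaps_le_star:
  assumes "infinite (gaps s M')" "M \<le>\<^sup>* M'"
  shows "infinite (gaps s M)"
proof
  assume "finite (gaps s M)"
  moreover have "gaps s M' \<subseteq> gaps s M \<union> {n. \<not> M n \<le> M' n}"
    using gaps_mono[of _ s M' M] by blast
  ultimately show False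
    using assms finite_subset unfolding le_star_def by blast
qed

text \<open>With \<open>n + 2\<close> instead of \<open>n + 1\<close>, consecutive points of an
  orbit of \<open>g'\<close> leave a number between them, so the range of the orbit is
  coinfinite.\<close>

lemma mono_majorant:
  fixes g :: "nat \<Rightarrow> nat"
  obtains g' where "mono g'" "\<And>n. n + 2 \<le> g' n" "\<And>n. g n \<le> g' n"
proof
  let ?g = "\<lambda>n. (\<Sum>i\<le>n. g i) + n + 2"
  show "mono ?g" by (intro monoI add_mono sum_mono2) auto
  show "n + 2 \<le> ?g n" for n by simp
  have "g n \<le> (\<Sum>i\<le>n. g i)" for n by (intro member_le_sum) auto
  then show "g n \<le> ?g n" for n using le_trans[of "g n" "\<Sum>i\<le>n. g i" "?g n"] by simp
qed

lemma strict_mono_bracket: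
  fixes a :: "nat \<Rightarrow> nat"
  assumes "strict_mono a" "a 0 \<le> n"
  obtains k where "a k \<le> n" "n < a (Suc k)"
proof -
  have "\<exists>m. n < a m" using strict_mono_imp_increasing[OF assms(1), of "Suc n"] by (metis Suc_le_lessD)
  then obtain m where m: "n < a m" "\<And>i. i < m \<Longrightarrow> a i \<le> n"
    using exists_least_iff[of "\<lambda>m. n < a m"] by (metis not_le)
  then obtain k where "m = Suc k" using assms(2) by (cases m) auto
  then show ?thesis using m that by blast
qed

lemma infinite_nat_next:
  assumes "infinite (B :: nat set)"
  shows "\<exists>b\<in>B. n < b"
  using assms by (meson infinite_nat_iff_unbounded)

text \<open>In general, a set \<^term>\<open>range a\<close> with \<^term>\<open>a (Suc k) = g (a k)\<close> is used: two
  disjoint intervals of the form \<^term>\<open>{b..<M b}\<close> between \<^term>\<open>a k\<close> and \<^term>\<open>a (k + 2)\<close> cannot both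
  contain \<^term>\<open>a (k + 1)\<close>. When small families are bounded, \<^term>\<open>g\<close> can be chosen to dominate,
  and every other interval between consecutive \<^term>\<open>a k\<close> can be filled.\<close>
lemma exists_gaps:
  assumes \<B>: "|\<B>| <o dominating_number" "\<And>B. B \<in> \<B> \<Longrightarrow> infinite B"
    and E: "|E| <o dominating_number"
  shows "\<exists>s. infinite s \<and> infinite (- s) \<and> (\<forall>B\<in>\<B>. \<forall>M\<in>E. infinite (B \<inter> gaps s M))
    \<and> ((\<forall>A. |A| <o dominating_number \<longrightarrow> le_star_bounded A) \<longrightarrow> (\<forall>M\<in>E. infinite (gaps (- s) M)))"
proof -
  define b where "b B n = (SOME b. b \<in> B \<and> n < b)" for B and n :: nat
  have b: "b B n \<in> B" "n < b B n" if "infinite B" for B n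
    using someI_ex[of "\<lambda>b. b \<in> B \<and> n < b"] infinite_nat_next[OF that, of n] unfolding b_def by blast+
  \<comment> \<open>For c = \<open>b B n\<close> this is an element of \<open>B\<close> beyond both
    c and \<open>M c\<close>, so the intervals that \<open>M\<close> attaches to the two elements
    are disjoint.\<close>
  define b' where "b' B M n = b B (max (b B n) (M (b B n)))" for B and M :: "nat \<Rightarrow> nat" and n
  \<comment> \<open>A bound for every interval end met beyond \<open>n\<close>. The entry
    \<open>M n\<close> is for the full intervals, for which \<open>UNIV\<close> takes the place of
    \<open>B\<close>.\<close>
  define W where "W = (\<lambda>(B, M) n. Max {M n, M (b B n), M (b' B M n)})"
  have W: "M n \<le> W (B, M) n" "M (b B n) \<le> W (B, M) n" "M (b' B M n) \<le> W (B, M) n" for B M n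
    unfolding W_def by auto
  have card: "|W ` (insert UNIV \<B> \<times> E)| <o dominating_number"
  proof -
    have "|{UNIV :: nat set}| <o dominating_number"
      by (intro card_of_finite_ordLess_Field Card_order_dominating_number
          infinite_Field_dominating_number) simp
    then have "|insert UNIV \<B>| <o dominating_number"
      using card_of_Un_ordLess_infinite_Field[OF infinite_Field_dominating_number
          Card_order_dominating_number _ \<B>(1), of "{UNIV}"] by simp
    then show ?thesis
      using card_of_Times_ordLess_Field[OF Card_order_dominating_number infinite_Field_dominating_number _ E]
        card_of_image ordLeq_ordLess_trans by blast
  qed
  have orbit: "strict_mono (\<lambda>k. (g ^^ k) (0::nat))" if "\<And>n. n + 2 \<le> g n" for g
    unfolding strict_mono_Suc_iff using that by (metis add_2_eq_Suc' funpow.simps(2) comp_apply lessI less_trans less_le_trans)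
  show ?thesis
  proof (cases "\<forall>A. |A| <o dominating_number \<longrightarrow> le_star_bounded A")
    case False
    obtain g0 where g0: "\<And>w. w \<in> W ` (insert UNIV \<B> \<times> E) \<Longrightarrow> \<not> g0 \<le>\<^sup>* w"
      using ordLess_not_dominating[OF card] unfolding dominating_def by blast
    obtain g where g: "mono g" "\<And>n. n + 2 \<le> g n" "\<And>n. g0 n \<le> g n"
      using mono_majorant[of g0] by blast
    define a where "a k = (g ^^ k) 0" for k
    have a0: "a 0 = 0" and aS: "a (Suc k) = g (a k)" for k unfolding a_def by auto
    have sm: "strict_mono a" using orbit[OF g(2)] unfolding a_def by blast
    have "infinite (range a)"
      using sm by (intro range_inj_infinite strict_mono_imp_inj_on)
    moreover have "Suc (a k) \<notin> range a" for k
    proof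
      assume "Suc (a k) \<in> range a"
      then obtain j where j: "a j = Suc (a k)" by auto
      then have "k < j" using sm by (metis lessI strict_mono_less)
      then have "a (Suc k) \<le> a j" using sm by (simp add: Suc_leI strict_mono_less_eq)
      then show False using g(2)[of "a k"] j aS[of k] by simp
    qed
    then have "(\<lambda>k. Suc (a k)) ` UNIV \<subseteq> - range a" by auto
    then have "infinite (- range a)"
      using range_inj_infinite[of "\<lambda>k. Suc (a k)"] strict_mono_imp_inj_on[OF sm] finite_subset
      by (metis (mono_tags, lifting) Suc_inject inj_on_def)
    moreover have "infinite (B \<inter> gaps (range a) M)" if BM: "B \<in> \<B>" "M \<in> E" for B M
      unfolding infinite_nat_iff_unbounded
    proof
      fix N
      have "infinite {n. \<not> g0 n \<le> W (B, M) n}"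
        using g0[of "W (B, M)"] BM unfolding le_star_def by blast
      then obtain n where n: "N < n" "W (B, M) n < g n"
        unfolding infinite_nat_iff_unbounded using g(3) by (metis (mono_tags, lifting) less_le_trans mem_Collect_eq not_le)
      obtain k where k: "a k \<le> n" "n < a (Suc k)"
        using strict_mono_bracket[OF sm, of n] a0 by auto
      \<comment> \<open>As \<open>n < a (Suc k)\<close> and \<open>g\<close> is monotone,
        \<open>g n\<close> is at most the next orbit point. Both intervals thus lie above
        \<open>a k\<close> and below \<open>a (Suc (Suc k))\<close>.\<close>
      have lt: "W (B, M) n < a (Suc (Suc k))"
        using n(2) monoD[OF g(1), of n "a (Suc k)"] k(2) aS[of "Suc k"] by simp
      let ?c = "b B n" and ?d = "b' B M n"
      have c: "?c \<in> B" "n < ?c" using b[OF \<B>(2)[OF BM(1)]] by blast+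
      have "?d \<in> B" "max ?c (M ?c) < ?d"
        unfolding b'_def using b[OF \<B>(2)[OF BM(1)]] by blast+
      then have d: "?d \<in> B" "?c < ?d" "M ?c < ?d" by simp_all
      have between: "x = a (Suc k)" if x: "x \<in> range a" "n < x" "x < a (Suc (Suc k))" for x
      proof -
        obtain j where j: "x = a j" using x(1) by auto
        then have "a k < a j" "a j < a (Suc (Suc k))" using x(2,3) k(1) by simp_all
        then have "k < j" "j < Suc (Suc k)" using strict_mono_less[OF sm] by blast+
        then have "j = Suc k" by simp
        then show ?thesis using j by simp
      qed
      have "?c \<in> gaps (range a) M \<or> ?d \<in> gaps (range a) M"
      proof (rule ccontr)
        assume "\<not> ?thesis"
        then obtain x y where "x \<in> range a" "?c \<le> x" "x < M ?c" "y \<in> range a" "?d \<le> y" "y < M ?d"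
          unfolding gaps_def by fastforce
        then have "x = a (Suc k)" "y = a (Suc k)" "x < y"
          using c d lt W(2)[of M B n] W(3)[of M B n] by (auto intro!: between)
        then show False by simp
      qed
      then show "\<exists>p>N. p \<in> B \<inter> gaps (range a) M"
        using c d n(1) by (metis IntI less_trans)
    qed
    ultimately show ?thesis using False by blast
  next
    case True
    then obtain g0 where g0: "\<And>w. w \<in> W ` (insert UNIV \<B> \<times> E) \<Longrightarrow> w \<le>\<^sup>* g0"
      using card unfolding le_star_bounded_def by blast
    obtain g where g: "mono g" "\<And>n. n + 2 \<le> g n" "\<And>n. g0 n \<le> g n"
      using mono_majorant[of g0] by blast
    define a where "a k = (g ^^ k) 0" for k
    have aS: "a (Suc k) = g (a k)" for k unfolding a_def by auto
    have sm: "strict_mono a" using orbit[OF g(2)] unfolding a_def by blast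
    define s where "s = (\<Union>k. {a (2 * k)..<a (2 * k + 1)})"
    have s_even: "{a (2 * k)..<a (2 * k + 1)} \<subseteq> s" for k unfolding s_def by blast
    have s_odd: "s \<inter> {a (2 * k + 1)..<a (2 * k + 2)} = {}" for k
    proof -
      have False if "a (2 * j) \<le> x" "x < a (2 * j + 1)" "a (2 * k + 1) \<le> x" "x < a (2 * k + 2)" for j x
      proof -
        have "a (2 * j) < a (2 * k + 2)" "a (2 * k + 1) < a (2 * j + 1)" using that by linarith+
        then have "2 * j < 2 * k + 2" "2 * k + 1 < 2 * j + 1" using strict_mono_less[OF sm] by blast+
        then show False by presburger
      qed
      then show ?thesis unfolding s_def by fastforce
    qed
    have ev: "\<exists>N. \<forall>n\<ge>N. W (B, M) n \<le> g n" if "B \<in> insert UNIV \<B>" "M \<in> E" for B M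
    proof -
      have "finite {n. \<not> W (B, M) n \<le> g0 n}" using g0[of "W (B, M)"] that unfolding le_star_def by blast
      then obtain N where "\<forall>n\<in>{n. \<not> W (B, M) n \<le> g0 n}. n < N" using finite_nat_set_iff_bounded by blast
      then have "\<forall>n\<ge>N. W (B, M) n \<le> g0 n" by (auto simp: not_less[symmetric])
      then show ?thesis using g(3) order_trans by blast
    qed
    have large: "n \<le> a k" if "n \<le> k" for n k
      using that strict_mono_imp_increasing[OF sm, of k] by simp
    have large': "n < a k" if "n < k" for n k
      using that strict_mono_imp_increasing[OF sm, of k] by simp
    have "infinite s"
      unfolding infinite_nat_iff_unbounded
    proof
      fix N
      have "a (2 * Suc N) \<in> s"
        using s_even[of "Suc N"] strict_monoD[OF sm, of "2 * Suc N" "2 * Suc N + 1"] by auto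
      moreover have "N < a (2 * Suc N)" by (rule large') simp
      ultimately show "\<exists>n>N. n \<in> s" by blast
    qed
    moreover have "infinite (- s)"
      unfolding infinite_nat_iff_unbounded
    proof
      fix N
      have "a (2 * N + 1) \<in> - s"
        using s_odd[of N] strict_monoD[OF sm, of "2 * N + 1" "2 * N + 2"] by auto
      moreover have "N < a (2 * N + 1)" by (rule large') simp
      ultimately show "\<exists>n>N. n \<in> - s" by blast
    qed
    moreover have "infinite (B \<inter> gaps s M)" if BM: "B \<in> \<B>" "M \<in> E" for B M
      unfolding infinite_nat_iff_unbounded
    proof
      fix N
      obtain N' where N': "\<And>n. N' \<le> n \<Longrightarrow> W (B, M) n \<le> g n" using ev BM by blast
      \<comment> \<open>The left end of an interval that \<open>s\<close> omits. It is so large that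
        \<open>g\<close> exceeds \<open>W\<close> there, so the omitted interval contains the one
        attached to the chosen element of \<open>B\<close> above it.\<close>
      let ?k = "N + N'" let ?n = "a (2 * ?k + 1)"
      have n: "N \<le> ?n" "N' \<le> ?n" by (rule large; simp)+
      have "M (b B ?n) \<le> a (2 * ?k + 2)"
        using N'[OF n(2)] W(2)[of M B ?n] aS[of "2 * ?k + 1"] by simp
      then have "{b B ?n..<M (b B ?n)} \<subseteq> {?n..<a (2 * ?k + 2)}"
        using b(2)[OF \<B>(2)[OF BM(1)], of ?n] by auto
      then have "b B ?n \<in> gaps s M" using s_odd[of ?k] unfolding gaps_def by blast
      then show "\<exists>p>N. p \<in> B \<inter> gaps s M"
        using b[OF \<B>(2)[OF BM(1)], of ?n] n(1) by (metis IntI le_less_trans)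
    qed
    moreover have "infinite (gaps (- s) M)" if M: "M \<in> E" for M
      unfolding infinite_nat_iff_unbounded
    proof
      fix N
      obtain N' where N': "\<And>n. N' \<le> n \<Longrightarrow> W (UNIV, M) n \<le> g n" using ev M by blast
      let ?k = "Suc (N + N')" let ?n = "a (2 * ?k)"
      have n: "N < ?n" "N' \<le> ?n" by (rule large', simp, rule large, simp)
      have "M ?n \<le> a (2 * ?k + 1)"
        using N'[OF n(2)] W(1)[of M ?n UNIV] aS[of "2 * ?k"] by simp
      then have "?n \<in> gaps (- s) M" using s_even[of ?k] unfolding gaps_def by fastforce
      then show "\<exists>p>N. p \<in> gaps (- s) M" using n(1) by blast
    qed
    ultimately show ?thesis by blast
  qed
qed

section \<open>The recursion along the cofinality\<close>

lemma finite_majorant: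
  assumes "finite Q" "Q \<subseteq> E" "E \<noteq> {}"
    and "\<And>f g. f \<in> E \<Longrightarrow> g \<in> E \<Longrightarrow> (\<lambda>n. max (f n) (g n)) \<in> E"
  shows "\<exists>M\<in>E. \<forall>f\<in>Q. \<forall>n::nat. f n \<le> (M n :: nat)"
  using assms(1,2)
proof (induction Q)
  case empty
  then show ?case using assms(3) by auto
next
  case (insert f Q)
  then obtain M where "M \<in> E" "\<forall>f\<in>Q. \<forall>n. f n \<le> M n" by auto
  then show ?case
    using assms(4)[of f M] insert.prems by (intro bexI[of _ "\<lambda>n. max (f n) (M n)"]) (auto simp: le_max_iff_disj)
qed

text \<open>Inserting 0 gives the empty set a maximum, so the closure is never empty. Closure under
  maxima lets finitely many requirements at one index be merged into one.\<close>

definition max_closure :: "(nat \<Rightarrow> nat) set \<Rightarrow> (nat \<Rightarrow> nat) set"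
  where "max_closure E = (\<lambda>T n. Max (insert 0 ((\<lambda>f. f n) ` T))) ` {T. finite T \<and> T \<subseteq> E}"

lemma max_closure_mono: "E \<subseteq> E' \<Longrightarrow> max_closure E \<subseteq> max_closure E'"
  unfolding max_closure_def by blast

lemma subset_max_closure: "E \<subseteq> max_closure E"
proof
  fix f assume "f \<in> E"
  moreover have "f = (\<lambda>n. Max (insert 0 ((\<lambda>f. f n) ` {f})))" by simp
  ultimately show "f \<in> max_closure E"
    unfolding max_closure_def by (intro image_eqI[of _ _ "{f}"]) auto
qed

lemma max_closure_nonempty: "max_closure E \<noteq> {}"
  unfolding max_closure_def by blast

lemma max_closure_max:
  assumes "f \<in> max_closure E" "g \<in> max_closure E"
  shows "(\<lambda>n. max (f n) (g n)) \<in> max_closure E"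
proof -
  obtain S T where ST: "finite S" "S \<subseteq> E" "finite T" "T \<subseteq> E"
    "f = (\<lambda>n. Max (insert 0 ((\<lambda>f. f n) ` S)))" "g = (\<lambda>n. Max (insert 0 ((\<lambda>f. f n) ` T)))"
    using assms unfolding max_closure_def by blast
  have "max (f n) (g n) = Max (insert 0 ((\<lambda>f. f n) ` (S \<union> T)))" for n
  proof -
    have "max (f n) (g n) = Max (insert 0 ((\<lambda>f. f n) ` S) \<union> insert 0 ((\<lambda>f. f n) ` T))"
      unfolding ST(5,6) using ST(1,3) by (subst Max_Un) auto
    also have "insert 0 ((\<lambda>f. f n) ` S) \<union> insert 0 ((\<lambda>f. f n) ` T) = insert 0 ((\<lambda>f. f n) ` (S \<union> T))"
      by blast
    finally show ?thesis .
  qed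
  then show ?thesis
    unfolding max_closure_def using ST by (intro image_eqI[of _ _ "S \<union> T"]) auto
qed

lemma card_of_max_closure:
  "|E| <o dominating_number \<Longrightarrow> |max_closure E| <o dominating_number"
  unfolding max_closure_def
  using card_of_image card_of_finite_subsets_ordLess ordLeq_ordLess_trans by blast

section \<open>Finite and cofinal subsets of well-orders\<close>

lemma Well_orderD:
  assumes "Well_order r"
  shows "i \<in> Field r \<Longrightarrow> (i, i) \<in> r"
    and "i \<in> Field r \<Longrightarrow> j \<in> Field r \<Longrightarrow> (i, j) \<in> r \<or> (j, i) \<in> r"
    and "(i, j) \<in> r \<Longrightarrow> (j, k) \<in> r \<Longrightarrow> (i, k) \<in> r"
    and "(i, j) \<in> r \<Longrightarrow> (j, i) \<in> r \<Longrightarrow> i = j"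
proof -
  have "refl_on (Field r) r" "total_on (Field r) r" "trans r" "antisym r"
    using assms unfolding order_on_defs by blast+
  then show "i \<in> Field r \<Longrightarrow> (i, i) \<in> r"
    "i \<in> Field r \<Longrightarrow> j \<in> Field r \<Longrightarrow> (i, j) \<in> r \<or> (j, i) \<in> r"
    "(i, j) \<in> r \<Longrightarrow> (j, k) \<in> r \<Longrightarrow> (i, k) \<in> r"
    "(i, j) \<in> r \<Longrightarrow> (j, i) \<in> r \<Longrightarrow> i = j"
    by (metis refl_onD, metis refl_onD total_on_def, metis transD, metis antisymD)
qed

lemma Well_order_finite_greatest:
  assumes r: "Well_order r" and "finite F" "F \<noteq> {}" "F \<subseteq> Field r"
  shows "\<exists>m\<in>F. \<forall>a\<in>F. (a, m) \<in> r"
  using assms(2-)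
proof (induction rule: finite_ne_induct)
  case (singleton x)
  then show ?case using Well_orderD(1)[OF r] by blast
next
  case (insert x F)
  then obtain m where m: "m \<in> F" "\<And>a. a \<in> F \<Longrightarrow> (a, m) \<in> r" by blast
  have mx: "m \<in> Field r" "x \<in> Field r" using insert.prems m(1) by blast+
  show ?case
  proof (cases "(x, m) \<in> r")
    case True
    then show ?thesis using m by blast
  next
    case False
    then have "(m, x) \<in> r" using Well_orderD(2)[OF r mx] by blast
    then have "(a, x) \<in> r" if "a \<in> F" for a using Well_orderD(3)[OF r m(2)[OF that]] by blast
    then show ?thesis using Well_orderD(1)[OF r mx(2)] by blast
  qed
qed

lemma infinite_cofinal:
  assumes r: "Well_order r" "infinite (Field r)" and A: "A \<subseteq> Field r" "cofinal A r"
  shows "infinite A"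
proof
  assume fin: "finite A"
  obtain a where "a \<in> Field r" using r(2) by fastforce
  then have "A \<noteq> {}" using A(2) unfolding cofinal_def by blast
  then obtain m where m: "m \<in> A" "\<forall>a\<in>A. (a, m) \<in> r"
    using Well_order_finite_greatest[OF r(1) fin _ A(1)] by blast
  then obtain b where "b \<in> A" "m \<noteq> b" "(m, b) \<in> r" using A unfolding cofinal_def by blast
  then show False using m(2) Well_orderD(4)[OF r(1)] by blast
qed

lemma not_cofinal_bounded:
  assumes r: "Well_order r" and K: "K \<subseteq> Field r" "\<not> cofinal K r"
  shows "\<exists>a\<in>Field r. \<forall>k\<in>K. (k, a) \<in> r"
proof -
  obtain a where a: "a \<in> Field r" "\<And>b. b \<in> K \<Longrightarrow> a = b \<or> (a, b) \<notin> r"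
    using K(2) unfolding cofinal_def by blast
  have "(k, a) \<in> r" if "k \<in> K" for k
  proof -
    have "k \<in> Field r" using that K(1) by blast
    then show ?thesis
      using a(2)[OF that] Well_orderD(1)[OF r a(1)] Well_orderD(2)[OF r a(1)] by blast
  qed
  then show ?thesis using a(1) by blast
qed

text \<open>A cofinal set \<open>A\<close> of least size carries two orders: the one inherited from
  \<dd>, whose initial segments exhaust a dominating set, and its own cardinal order
  \<open>r\<close>, whose initial segments are smaller than cf(\<dd>) and hence bounded in \<dd>.
  Uniting the segments of \<dd> along \<open>r\<close> keeps every \<open>E i\<close> smaller than
  \<dd>.\<close>

lemma cofinality_filtration:
  "\<exists>(r :: (nat \<Rightarrow> nat) rel) E. Card_order r \<and> infinite (Field r)
     \<and> r = cofinality dominating_number \<and> r \<le>o dominating_number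
     \<and> (\<forall>i j. (i, j) \<in> r \<longrightarrow> E i \<subseteq> E j)
     \<and> (\<forall>i\<in>Field r. |E i| <o dominating_number)
     \<and> (\<forall>f. \<exists>i\<in>Field r. \<exists>g\<in>E i. f \<le>\<^sup>* g)
     \<and> (\<forall>K. K \<subseteq> Field r \<longrightarrow> |K| <o r \<longrightarrow> (\<exists>i\<in>Field r. \<forall>k\<in>K. (k, i) \<in> r))
     \<and> (\<forall>i. E i \<noteq> {} \<and> (\<forall>f\<in>E i. \<forall>g\<in>E i. (\<lambda>n. max (f n) (g n)) \<in> E i))"
proof -
  let ?d = dominating_number
  obtain D where D: "dominating D" "?d = |D|" using dominating_number_attained by blast
  have FD: "Field ?d = D" unfolding D(2) by (rule Field_card_of)
  have wod: "Well_order ?d" using Card_order_dominating_number by (simp add: card_order_on_def)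
  note transd = Well_orderD(3)[OF wod] and antisymd = Well_orderD(4)[OF wod]
  obtain A where A: "A \<subseteq> Field ?d" "cofinal A ?d" "cofinality ?d = |A|"
    using cofinality_dominating_number by blast
  have infA: "infinite A"
    using infinite_cofinal[OF wod infinite_Field_dominating_number A(1,2)] .
  let ?r = "|A|"
  have FA: "Field ?r = A" by (simp add: Field_card_of)
  have wo: "Well_order ?r" by (rule card_of_Well_order)
  note trans = Well_orderD(3)[OF wo]
    and refl = Well_orderD(1)[OF wo, unfolded FA] and total = Well_orderD(2)[OF wo, unfolded FA]
  have small: "\<exists>a\<in>D. \<forall>k\<in>K. (k, a) \<in> ?d" if "K \<subseteq> D" "|K| <o ?r" for K
  proof -
    have "\<not> cofinal K ?d"
      using cofinality_le[of K ?d] that A(3) FD not_ordLess_ordLeq by metis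
    then show ?thesis using not_cofinal_bounded[OF wod] that(1) FD by metis
  qed
  have under: "|under ?r i| <o ?r" if "i \<in> A" for i
  proof -
    have "under ?r i = underS ?r i \<union> {i}"
      unfolding under_def underS_def using refl[OF that] by auto
    moreover have "|underS ?r i| <o ?r"
      using card_of_underS[OF card_of_Card_order, of i A] that FA by simp
    moreover have "|{i}| <o ?r"
      by (rule card_of_finite_ordLess_Field[OF card_of_Card_order]) (use infA FA in simp_all)
    ultimately have "under ?r i = underS ?r i \<union> {i}" "|underS ?r i \<union> {i}| <o ?r"
      using card_of_Un_ordLess_infinite[OF infA] by blast+
    then show ?thesis by simp
  qed
  have "\<exists>a\<in>D. \<forall>k\<in>under ?r i. (k, a) \<in> ?d" if "i \<in> A" for i
    using small[OF _ under[OF that]] A(1) FD FA under_Field[of ?r i] by auto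
  then obtain c where c: "\<And>i. i \<in> A \<Longrightarrow> c i \<in> D" "\<And>i k. i \<in> A \<Longrightarrow> k \<in> under ?r i \<Longrightarrow> (k, c i) \<in> ?d"
    by metis
  define E where "E i = max_closure (\<Union>j\<in>under ?r i. underS ?d j)" for i
  have mono: "E i \<subseteq> E j" if "(i, j) \<in> ?r" for i j
    unfolding E_def using trans[OF _ that]
    by (intro max_closure_mono UN_mono) (auto simp: under_def)
  have card: "|E i| <o ?d" if "i \<in> A" for i
  proof -
    have "underS ?d j \<subseteq> underS ?d (c i)" if "j \<in> under ?r i" for j
    proof
      fix k assume k: "k \<in> underS ?d j"
      have j: "(j, c i) \<in> ?d" using c(2)[OF \<open>i \<in> A\<close> that] .
      then have "(k, c i) \<in> ?d" using transd[of k j "c i"] k unfolding underS_def by simp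
      moreover have "k \<noteq> c i" using antisymd[OF j] k unfolding underS_def by auto
      ultimately show "k \<in> underS ?d (c i)" unfolding underS_def by simp
    qed
    then have "(\<Union>j\<in>under ?r i. underS ?d j) \<subseteq> underS ?d (c i)" by blast
    moreover have "|underS ?d (c i)| <o ?d"
      using card_of_underS[OF Card_order_dominating_number] c(1)[OF that] FD by simp
    ultimately show ?thesis
      unfolding E_def by (intro card_of_max_closure) (meson card_of_mono1 ordLeq_ordLess_trans)
  qed
  have dom: "\<exists>i\<in>A. \<exists>g\<in>E i. f \<le>\<^sup>* g" for f
  proof -
    obtain g where g: "g \<in> D" "f \<le>\<^sup>* g" using D(1) unfolding dominating_def by blast
    then obtain i where i: "i \<in> A" "g \<noteq> i" "(g, i) \<in> ?d" using A(2) FD unfolding cofinal_def by blast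
    then have "g \<in> (\<Union>j\<in>under ?r i. underS ?d j)"
      using refl[OF i(1)] unfolding under_def underS_def by blast
    then show ?thesis using subset_max_closure i(1) g(2) unfolding E_def by blast
  qed
  \<comment> \<open>Regularity of the cofinality: \<open>c\<close> sends \<open>K\<close> to a set
    bounded by some \<open>a\<close> in the order of \<dd>. An \<open>i\<close> in \<open>A\<close>
    strictly above \<open>a\<close> bounds \<open>K\<close> in \<open>r\<close>, because
    \<open>i\<close> below \<open>k\<close> in \<open>r\<close> would put \<open>i\<close> below
    \<open>c k\<close>.\<close>
  have reg: "\<exists>i\<in>A. \<forall>k\<in>K. (k, i) \<in> ?r" if K: "K \<subseteq> A" "|K| <o ?r" for K
  proof -
    have "|c ` K| <o ?r" using K(2) card_of_image ordLeq_ordLess_trans by blast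
    moreover have "c ` K \<subseteq> D" using c(1) K(1) by (intro image_subsetI) (rule c(1), rule subsetD)
    ultimately obtain a where a: "a \<in> D" "\<forall>k\<in>c ` K. (k, a) \<in> ?d" using small[of "c ` K"] by metis
    then obtain i where i: "i \<in> A" "a \<noteq> i" "(a, i) \<in> ?d" using A(2) FD unfolding cofinal_def by blast
    have "(k, i) \<in> ?r" if "k \<in> K" for k
    proof (rule ccontr)
      assume "(k, i) \<notin> ?r"
      then have "i \<in> under ?r k"
        using total[OF i(1), of k] K(1) that unfolding under_def by blast
      then have "(i, c k) \<in> ?d" using c(2)[OF subsetD[OF K(1) that]] by simp
      then have "(i, a) \<in> ?d" using a(2) that transd[of i "c k" a] by simp
      then show False using i(2,3) antisymd by blast
    qed
    then show ?thesis using i(1) by blast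
  qed
  have le: "?r \<le>o ?d"
    unfolding D(2) using A(1) FD by (intro card_of_mono1) simp
  show ?thesis
  proof (intro exI conjI)
    show "Card_order ?r" by (rule card_of_Card_order)
    show "infinite (Field ?r)" using infA FA by simp
    show "?r = cofinality ?d" using A(3) by simp
    show "?r \<le>o ?d" by (rule le)
    show "\<forall>i j. (i, j) \<in> ?r \<longrightarrow> E i \<subseteq> E j" using mono by blast
    show "\<forall>i\<in>Field ?r. |E i| <o ?d" using card FA by blast
    show "\<forall>f. \<exists>i\<in>Field ?r. \<exists>g\<in>E i. f \<le>\<^sup>* g" using dom FA by blast
    show "\<forall>K. K \<subseteq> Field ?r \<longrightarrow> |K| <o ?r \<longrightarrow> (\<exists>i\<in>Field ?r. \<forall>k\<in>K. (k, i) \<in> ?r)"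
      using reg FA by metis
    show "\<forall>i. E i \<noteq> {} \<and> (\<forall>f\<in>E i. \<forall>g\<in>E i. (\<lambda>n. max (f n) (g n)) \<in> E i)"
      unfolding E_def using max_closure_nonempty max_closure_max by blast
  qed
qed

section \<open>Recursive choice of the sparse sets\<close>

definition all_gaps :: "((nat \<Rightarrow> nat) \<Rightarrow> nat set) \<Rightarrow> ((nat \<Rightarrow> nat) \<times> (nat \<Rightarrow> nat)) set \<Rightarrow> nat set"
  where "all_gaps s T = (\<Inter>(i, M)\<in>T. gaps (s i) M)"

text \<open>The requirements in \<open>T\<close> with the greatest index \<open>j\<close> follow
  from a single one, given by a common majorant in \<open>E j\<close>. The others have indices below
  \<open>j\<close>, which is the situation of \<open>step\<close>.\<close>

lemma infinite_all_gaps: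
  assumes r: "Well_order r"
    and E: "\<And>i. E i \<noteq> {}" "\<And>i f g. f \<in> E i \<Longrightarrow> g \<in> E i \<Longrightarrow> (\<lambda>n. max (f n) (g n)) \<in> E i"
    and J: "J \<subseteq> Field r"
    and step: "\<And>j T M. j \<in> J \<Longrightarrow> finite T \<Longrightarrow> T \<subseteq> Sigma (underS r j) E \<Longrightarrow> M \<in> E j
      \<Longrightarrow> infinite (all_gaps s T \<inter> gaps (s j) M)"
    and T: "finite T" "T \<subseteq> Sigma J E"
  shows "infinite (all_gaps s T)"
proof (cases "T = {}")
  case True
  then show ?thesis by (simp add: all_gaps_def)
next
  case False
  have "finite (fst ` T)" "fst ` T \<noteq> {}" "fst ` T \<subseteq> Field r" using T False J by auto
  from Well_order_finite_greatest[OF r this]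
  obtain j where j: "j \<in> fst ` T" "\<And>k. k \<in> fst ` T \<Longrightarrow> (k, j) \<in> r" by blast
  have jJ: "j \<in> J" using j(1) T(2) by auto
  let ?T = "{p \<in> T. fst p \<noteq> j}" and ?Q = "snd ` {p \<in> T. fst p = j}"
  have "finite ?Q" "?Q \<subseteq> E j" using T by auto
  then obtain M where M: "M \<in> E j" "\<forall>f\<in>?Q. \<forall>n. f n \<le> M n"
    using finite_majorant[of ?Q "E j"] E by blast
  have "?T \<subseteq> Sigma (underS r j) E"
    using T(2) j(2) by (force simp: underS_def)
  then have "infinite (all_gaps s ?T \<inter> gaps (s j) M)"
    using step[OF jJ _ _ M(1)] T(1) by simp
  moreover have "all_gaps s ?T \<inter> gaps (s j) M \<subseteq> all_gaps s T"
  proof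
    fix p assume p: "p \<in> all_gaps s ?T \<inter> gaps (s j) M"
    have "p \<in> gaps (s i) M'" if "(i, M') \<in> T" for i M'
    proof (cases "i = j")
      case True
      then have "M' p \<le> M p" using M(2) that by force
      then show ?thesis using True p gaps_mono by blast
    next
      case False
      then show ?thesis using p that unfolding all_gaps_def by force
    qed
    then show "p \<in> all_gaps s T" unfolding all_gaps_def by blast
  qed
  ultimately show ?thesis using finite_subset by blast
qed

lemma gap_family:
  "\<exists>(r :: (nat \<Rightarrow> nat) rel) s (F :: nat filter). Card_order r \<and> infinite (Field r)
     \<and> r = cofinality dominating_number \<and> r \<le>o dominating_number
     \<and> (\<forall>K. K \<subseteq> Field r \<longrightarrow> |K| <o r \<longrightarrow> (\<exists>i\<in>Field r. \<forall>k\<in>K. (k, i) \<in> r))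
     \<and> F \<noteq> bot \<and> F \<le> sequentially
     \<and> (\<forall>i\<in>Field r. infinite (s i) \<and> infinite (- s i))
     \<and> (\<forall>M. \<exists>i\<in>Field r. \<forall>j. (i, j) \<in> r \<longrightarrow> (\<forall>\<^sub>F p in F. p \<in> gaps (s j) M))
     \<and> ((\<forall>A. |A| <o dominating_number \<longrightarrow> le_star_bounded A)
         \<longrightarrow> (\<forall>M. \<exists>i\<in>Field r. infinite (gaps (- s i) M)))
     \<and> (\<exists>A. |A| \<le>o r \<and> \<not> le_star_bounded A)"
proof -
  let ?d = dominating_number
  obtain r :: "(nat \<Rightarrow> nat) rel" and E where r: "Card_order r" "infinite (Field r)"
      "r = cofinality ?d" "r \<le>o ?d"
    and mono': "\<forall>i j. (i, j) \<in> r \<longrightarrow> E i \<subseteq> E j"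
    and card': "\<forall>i\<in>Field r. |E i| <o ?d"
    and dom': "\<forall>f. \<exists>i\<in>Field r. \<exists>g\<in>E i. f \<le>\<^sup>* g"
    and reg: "\<forall>K. K \<subseteq> Field r \<longrightarrow> |K| <o r \<longrightarrow> (\<exists>i\<in>Field r. \<forall>k\<in>K. (k, i) \<in> r)"
    and E': "\<forall>i. E i \<noteq> {} \<and> (\<forall>f\<in>E i. \<forall>g\<in>E i. (\<lambda>n. max (f n) (g n)) \<in> E i)"
    using cofinality_filtration by (elim exE conjE) (rule that)
  have mono: "(i, j) \<in> r \<Longrightarrow> E i \<subseteq> E j" for i j using mono' by simp
  have card: "i \<in> Field r \<Longrightarrow> |E i| <o ?d" for i using card' by simp
  note dom = dom'[rule_format]
  have E: "E i \<noteq> {}" "f \<in> E i \<Longrightarrow> g \<in> E i \<Longrightarrow> (\<lambda>n. max (f n) (g n)) \<in> E i" for i f g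
    using E' by simp_all
  have wo: "Well_order r" using r(1) by (simp add: card_order_on_def)
  let ?bdd = "\<forall>A. |A| <o ?d \<longrightarrow> le_star_bounded A"
  define P where "P f i t \<longleftrightarrow> (i \<in> Field r \<longrightarrow> infinite t \<and> infinite (- t)
      \<and> (\<forall>T. finite T \<longrightarrow> T \<subseteq> Sigma (underS r i) E \<longrightarrow>
            (\<forall>M\<in>E i. infinite (all_gaps f T \<inter> gaps t M)))
      \<and> (?bdd \<longrightarrow> (\<forall>M\<in>E i. infinite (gaps (- t) M))))" for f i t
  have "\<exists>s. \<forall>i. P s i (s i)"
  proof (rule dependent_wf_choice)
    show "wf (r - Id)" using wo unfolding well_order_on_def by blast
  next
    fix f g :: "(nat \<Rightarrow> nat) \<Rightarrow> nat set" and i t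
    assume eq: "\<And>j. (j, i) \<in> r - Id \<Longrightarrow> f j = g j"
    have "all_gaps f T = all_gaps g T" if T: "T \<subseteq> Sigma (underS r i) E" for T
      unfolding all_gaps_def
    proof (rule INF_cong[OF refl])
      fix p assume "p \<in> T"
      then have "fst p \<in> underS r i" using T by auto
      then have "f (fst p) = g (fst p)" using eq unfolding underS_def by auto
      then show "(case p of (i, M) \<Rightarrow> gaps (f i) M) = (case p of (i, M) \<Rightarrow> gaps (g i) M)"
        by (simp add: case_prod_beta)
    qed
    then show "P f i t = P g i t" unfolding P_def by auto
  next
    fix i f assume IH: "\<And>j. (j, i) \<in> r - Id \<Longrightarrow> P f j (f j)"
    show "\<exists>t. P f i t"
    proof (cases "i \<in> Field r")
      case True
      let ?S = "Sigma (underS r i) E" and ?\<B> = "all_gaps f ` {T. finite T \<and> T \<subseteq> Sigma (underS r i) E}"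
      have IH': "infinite (all_gaps f T \<inter> gaps (f j) M)"
        if "j \<in> underS r i" "finite T" "T \<subseteq> Sigma (underS r j) E" "M \<in> E j" for j T M
      proof -
        have "(j, i) \<in> r - Id" "j \<in> Field r" using that(1) unfolding underS_def Field_def by auto
        then show ?thesis using IH[of j] that unfolding P_def by blast
      qed
      have inf: "infinite B" if B: "B \<in> ?\<B>" for B
      proof -
        obtain T where T: "finite T" "T \<subseteq> ?S" "B = all_gaps f T" using B by blast
        have "underS r i \<subseteq> Field r" unfolding underS_def Field_def by blast
        from infinite_all_gaps[OF wo E this IH' T(1,2)] show ?thesis unfolding T(3) by blast
      qed
      \<comment> \<open>Since the \<open>E j\<close> increase, all earlier requirements fit into a
        product of two sets smaller than \<dd>; this is where short initial segments of
        \<open>r\<close> matter.\<close>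
      have "?S \<subseteq> underS r i \<times> E i"
        using mono unfolding underS_def by blast
      moreover have "|underS r i| <o ?d"
        using card_of_underS[OF r(1) True] r(4) ordLess_ordLeq_trans by blast
      then have "|underS r i \<times> E i| <o ?d"
        by (intro card_of_Times_ordLess_Field card[OF True] Card_order_dominating_number
            infinite_Field_dominating_number)
      ultimately have "|?S| <o ?d" by (meson card_of_mono1 ordLeq_ordLess_trans)
      then have "|?\<B>| <o ?d"
        using card_of_finite_subsets_ordLess card_of_image ordLeq_ordLess_trans by blast
      from exists_gaps[OF this inf card[OF True]] obtain t where t: "infinite t" "infinite (- t)"
        "\<forall>B\<in>?\<B>. \<forall>M\<in>E i. infinite (B \<inter> gaps t M)" "?bdd \<longrightarrow> (\<forall>M\<in>E i. infinite (gaps (- t) M))"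
        by blast
      have "P f i t" unfolding P_def using t by blast
      then show ?thesis by blast
    qed (auto simp: P_def)
  qed
  then obtain s where s: "\<And>i. P s i (s i)" by blast
  have s_all_gaps: "infinite (all_gaps s T \<inter> gaps (s j) M)"
    if "j \<in> Field r" "finite T" "T \<subseteq> Sigma (underS r j) E" "M \<in> E j" for j T M
    using s[of j, unfolded P_def, THEN mp, OF that(1), THEN conjunct2, THEN conjunct2, THEN conjunct1]
      that(2-) by simp
  \<comment> \<open>Meeting with \<open>sequentially\<close> makes finite modifications harmless.
    The filter stays proper because the finite intersections are infinite, not merely
    nonempty.\<close>
  define F where "F = inf (INF (i, M)\<in>Sigma (Field r) E. principal (gaps (s i) M)) sequentially"
  have F_bot: "F \<noteq> bot"
  proof
    assume "F = bot"
    then have "eventually (\<lambda>_. False) F" by simp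
    then obtain Q R where QR: "eventually Q (INF (i, M)\<in>Sigma (Field r) E. principal (gaps (s i) M))"
      "eventually R sequentially" "\<And>p. Q p \<Longrightarrow> R p \<Longrightarrow> False"
      unfolding F_def eventually_inf by blast
    obtain T where T: "T \<subseteq> Sigma (Field r) E" "finite T"
      "eventually Q (INF (i, M)\<in>T. principal (gaps (s i) M))"
      using eventually_INF[THEN iffD1, OF QR(1)] by blast
    have "(INF (i, M)\<in>T. principal (gaps (s i) M)) = principal (all_gaps s T)"
      unfolding all_gaps_def case_prod_beta by (rule INF_principal_finite[OF T(2)])
    then have Q: "\<And>p. p \<in> all_gaps s T \<Longrightarrow> Q p" using T(3) by (simp add: eventually_principal)
    have "infinite (all_gaps s T)"
      by (rule infinite_all_gaps[OF wo E subset_refl _ T(2,1)]) (assumption | rule s_all_gaps)+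
    moreover obtain N where N: "\<And>n. N \<le> n \<Longrightarrow> R n" using QR(2) unfolding eventually_sequentially by blast
    ultimately obtain p where "N \<le> p" "p \<in> all_gaps s T" by (meson infinite_nat_iff_unbounded_le)
    then show False using Q N QR(3) by blast
  qed
  have F_seq: "F \<le> sequentially" unfolding F_def by simp
  have s_inf: "\<forall>i\<in>Field r. infinite (s i) \<and> infinite (- s i)" using s unfolding P_def by blast
  have s_gaps: "\<forall>M. \<exists>i\<in>Field r. \<forall>j. (i, j) \<in> r \<longrightarrow> (\<forall>\<^sub>F p in F. p \<in> gaps (s j) M)"
  proof
    fix M
    obtain i g where i: "i \<in> Field r" "g \<in> E i" "M \<le>\<^sup>* g" using dom by blast
    have "\<forall>\<^sub>F p in sequentially. M p \<le> g p"
      using i(3) unfolding le_star_def cofinite_eq_sequentially[symmetric] eventually_cofinite .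
    then have ev: "\<forall>\<^sub>F p in F. M p \<le> g p" using F_seq by (rule filter_leD[rotated])
    have "\<forall>\<^sub>F p in F. p \<in> gaps (s j) M" if j: "(i, j) \<in> r" for j
    proof -
      have "(j, g) \<in> Sigma (Field r) E" using j mono i(2) unfolding Field_def by blast
      then have "F \<le> principal (gaps (s j) g)"
        unfolding F_def by (intro le_infI1 INF_lower2[of "(j, g)"]) auto
      then have "\<forall>\<^sub>F p in F. p \<in> gaps (s j) g"
        by (rule filter_leD) (simp add: eventually_principal)
      with ev show ?thesis by eventually_elim (rule gaps_mono)
    qed
    then show "\<exists>i\<in>Field r. \<forall>j. (i, j) \<in> r \<longrightarrow> (\<forall>\<^sub>F p in F. p \<in> gaps (s j) M)"
      using i(1) by blast
  qed
  have s_full: "?bdd \<longrightarrow> (\<forall>M. \<exists>i\<in>Field r. infinite (gaps (- s i) M))"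
  proof (intro impI allI)
    fix M assume bdd: ?bdd
    obtain i g where i: "i \<in> Field r" "g \<in> E i" "M \<le>\<^sup>* g" using dom by blast
    then have "infinite (gaps (- s i) g)" using s[of i] bdd unfolding P_def by blast
    then show "\<exists>i\<in>Field r. infinite (gaps (- s i) M)" using i infinite_gaps_le_star by blast
  qed
  \<comment> \<open>The bounding number is at most cf(\<dd>): pick for each \<open>i\<close> a
    function that \<open>E i\<close> does not dominate. A bound of them all would lie below a member
    of some \<open>E i\<close>.\<close>
  have unb: "\<exists>A. |A| \<le>o r \<and> \<not> le_star_bounded A"
  proof -
    have "\<exists>g. \<forall>f\<in>E i. \<not> g \<le>\<^sup>* f" if "i \<in> Field r" for i
      using ordLess_not_dominating[OF card[OF that]] unfolding dominating_def by blast
    then obtain g where g: "\<And>i f. i \<in> Field r \<Longrightarrow> f \<in> E i \<Longrightarrow> \<not> g i \<le>\<^sup>* f" by metis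
    have "|g ` Field r| \<le>o r"
      using card_of_image card_of_Field_ordIso[OF r(1)] ordLeq_ordIso_trans by blast
    moreover have "\<not> le_star_bounded (g ` Field r)"
    proof
      assume "le_star_bounded (g ` Field r)"
      then obtain h where h: "\<And>i. i \<in> Field r \<Longrightarrow> g i \<le>\<^sup>* h" unfolding le_star_bounded_def by blast
      obtain i f where "i \<in> Field r" "f \<in> E i" "h \<le>\<^sup>* f" using dom by blast
      then show False using g h le_star_trans by blast
    qed
    ultimately show ?thesis by blast
  qed
  show ?thesis
    by (intro exI[of _ r] exI[of _ s] exI[of _ F] conjI; rule r reg F_bot F_seq s_inf s_gaps s_full unb)
qed

section \<open>Boundedness with respect to a filter\<close>

definition filter_bounded :: "nat filter \<Rightarrow> (nat \<Rightarrow> nat) set \<Rightarrow> bool"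
  where "filter_bounded F A \<longleftrightarrow> (\<exists>g. \<forall>f\<in>A. \<forall>\<^sub>F n in F. f n \<le> g n)"

lemma filter_bounded_not_dominating:
  assumes F: "F \<noteq> bot" "F \<le> sequentially" and A: "filter_bounded F A"
  shows "\<not> dominating A"
proof
  assume "dominating A"
  obtain g where g: "\<And>f. f \<in> A \<Longrightarrow> \<forall>\<^sub>F n in F. f n \<le> g n"
    using A unfolding filter_bounded_def by blast
  obtain f where f: "f \<in> A" "(\<lambda>n. Suc (g n)) \<le>\<^sup>* f"
    using \<open>dominating A\<close> unfolding dominating_def by blast
  have "\<forall>\<^sub>F n in sequentially. Suc (g n) \<le> f n"
    using f(2) unfolding le_star_def cofinite_eq_sequentially[symmetric] eventually_cofinite .
  then have "\<forall>\<^sub>F n in F. Suc (g n) \<le> f n" using F(2) by (rule filter_leD[rotated])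
  with g[OF f(1)] have "\<forall>\<^sub>F n in F. False" by eventually_elim simp
  then show False using F(1) by (simp add: eventually_False)
qed

lemma filter_bounded_Union:
  assumes F: "F \<le> sequentially" and "countable \<A>" "\<And>A. A \<in> \<A> \<Longrightarrow> filter_bounded F A"
  shows "filter_bounded F (\<Union>\<A>)"
proof (cases "\<A> = {}")
  case True
  then show ?thesis by (simp add: filter_bounded_def)
next
  case False
  have "\<forall>i. \<exists>g. \<forall>f\<in>from_nat_into \<A> i. \<forall>\<^sub>F n in F. f n \<le> g n"
    using assms(3)[OF from_nat_into[OF False]] unfolding filter_bounded_def by blast
  then obtain g where g: "\<And>i f. f \<in> from_nat_into \<A> i \<Longrightarrow> \<forall>\<^sub>F n in F. f n \<le> g i n" by metis
  have "\<forall>\<^sub>F n in F. f n \<le> (\<Sum>i\<le>n. g i n)" if f: "f \<in> \<Union>\<A>" for f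
  proof -
    obtain i where i: "f \<in> from_nat_into \<A> i"
      using f from_nat_into_surj[OF \<open>countable \<A>\<close>] by (metis UnionE)
    have "\<forall>\<^sub>F n in F. i \<le> n" using F eventually_ge_at_top by (rule filter_leD)
    with g[OF i] show ?thesis
    proof eventually_elim
      case (elim n)
      have "g i n \<le> (\<Sum>i\<le>n. g i n)" using elim(2) by (intro member_le_sum) auto
      then show ?case using elim(1) by simp
    qed
  qed
  then show ?thesis
    unfolding filter_bounded_def by (intro exI[of _ "\<lambda>n. \<Sum>i\<le>n. g i n"] ballI)
qed

locale gap_scale =
  fixes r :: "'i rel" and s :: "'i \<Rightarrow> nat set" and F :: "nat filter"
  assumes card_order: "Card_order r" and infinite_Field: "infinite (Field r)"
    and bound: "\<And>K. K \<subseteq> Field r \<Longrightarrow> |K| <o r \<Longrightarrow> \<exists>i\<in>Field r. \<forall>k\<in>K. (k, i) \<in> r"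
    and F_bot: "F \<noteq> bot" and F_sequentially: "F \<le> sequentially"
    and infinite_s: "\<And>i. i \<in> Field r \<Longrightarrow> infinite (s i)"
    and eventually_gaps: "\<And>M. \<exists>i\<in>Field r. \<forall>j. (i, j) \<in> r \<longrightarrow> (\<forall>\<^sub>F p in F. p \<in> gaps (s j) M)"
begin

text \<open>Take one \<open>s i\<close> sparse enough for all of \<open>H\<close>, and let
  \<open>g p\<close> be its first element from \<open>p\<close> on. If \<open>s i\<close> avoids
  \<open>{p..<f p}\<close>, then this element is at least \<open>f p\<close>.\<close>

lemma filter_bounded_small:
  assumes "|H| <o r"
  shows "filter_bounded F H"
proof -
  from eventually_gaps obtain c where c: "\<And>M. c M \<in> Field r"
    "\<And>M j. (c M, j) \<in> r \<Longrightarrow> \<forall>\<^sub>F p in F. p \<in> gaps (s j) M" by metis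
  have "|c ` H| <o r" using assms card_of_image ordLeq_ordLess_trans by blast
  moreover have "c ` H \<subseteq> Field r" using c(1) by blast
  ultimately obtain i where i: "i \<in> Field r" "\<forall>k\<in>c ` H. (k, i) \<in> r" using bound by metis
  define g where "g p = (LEAST q. q \<in> s i \<and> p \<le> q)" for p
  have g: "g p \<in> s i" "p \<le> g p" for p
  proof -
    have "\<exists>q. q \<in> s i \<and> p \<le> q" using infinite_s[OF i(1)] unfolding infinite_nat_iff_unbounded_le by blast
    then show "g p \<in> s i" "p \<le> g p" unfolding g_def by (metis (mono_tags, lifting) LeastI_ex)+
  qed
  have "\<forall>\<^sub>F p in F. f p \<le> g p" if "f \<in> H" for f
  proof -
    have "\<forall>\<^sub>F p in F. p \<in> gaps (s i) f" using c(2) i(2) that by simp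
    then show ?thesis
    proof eventually_elim
      case (elim p)
      then have "g p \<notin> {p..<f p}" using g(1)[of p] unfolding gaps_def by blast
      then show ?case using g(2)[of p] by simp
    qed
  qed
  then show ?thesis unfolding filter_bounded_def by (intro exI[of _ g] ballI)
qed

text \<open>Injectivity of \<open>s\<close> is not assumed. Each infinite set \<open>t\<close> meets
  every \<open>{p..<M t p}\<close> for a suitable \<open>M t\<close>; if there were fewer than
  \<open>r\<close> values, some \<open>s i\<close> would be sparse for the functions of all values,
  including its own.\<close>

lemma card_of_range: "|s ` Field r| =o r"
proof -
  have le: "|s ` Field r| \<le>o r"
    using card_of_image card_of_Field_ordIso[OF card_order] ordLeq_ordIso_trans by blast
  have "\<not> |s ` Field r| <o r"
  proof
    assume less: "|s ` Field r| <o r"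
    define M where "M t p = Suc (LEAST q. q \<in> t \<and> p \<le> q)" for t :: "nat set" and p
    have M: "gaps t (M t) = {}" if t: "infinite t" for t
    proof -
      have "p \<notin> gaps t (M t)" for p
      proof -
        have "\<exists>q. q \<in> t \<and> p \<le> q" using t unfolding infinite_nat_iff_unbounded_le by blast
        from LeastI_ex[OF this] show ?thesis unfolding gaps_def M_def by auto
      qed
      then show ?thesis by blast
    qed
    from eventually_gaps obtain c where c: "\<And>M. c M \<in> Field r"
      "\<And>M j. (c M, j) \<in> r \<Longrightarrow> \<forall>\<^sub>F p in F. p \<in> gaps (s j) M" by metis
    have "|(\<lambda>t. c (M t)) ` s ` Field r| <o r" using less card_of_image ordLeq_ordLess_trans by blast
    moreover have "(\<lambda>t. c (M t)) ` s ` Field r \<subseteq> Field r" using c(1) by blast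
    ultimately obtain i where i: "i \<in> Field r" "\<forall>k\<in>(\<lambda>t. c (M t)) ` s ` Field r. (k, i) \<in> r"
      using bound by metis
    then have "\<forall>\<^sub>F p in F. p \<in> gaps (s i) (M (s i))" using c(2) by simp
    then show False using M[OF infinite_s[OF i(1)]] F_bot by (simp add: eventually_False)
  qed
  then show ?thesis
    using le ordLeq_iff_ordLess_or_ordIso by blast
qed

text \<open>Arguments from the countable set of finite sets need no bound of their own, because the
  first \<^term>\<open>p\<close> bits of an argument that avoids \<^term>\<open>{p..<M p}\<close> leave finitely many cases.
  Arguments from the small part are fixed and handled by induction on the dimension.\<close>
lemma filter_bounded_power:
  assumes Y: "|Y| <o r"
  defines "Z \<equiv> s ` Field r \<union> Y \<union> Collect finite"
  assumes I: "finite (I :: 'c set)"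
    and \<psi>: "\<And>z n. z \<in> PiE I (\<lambda>_. Z) \<Longrightarrow> \<exists>m. \<forall>z'\<in>PiE I (\<lambda>_. Z).
      (\<forall>i\<in>I. z' i \<inter> {..<m} = z i \<inter> {..<m}) \<longrightarrow> \<psi> z' n \<le> (\<psi> z n :: nat)"
  shows "filter_bounded F (\<psi> ` PiE I (\<lambda>_. Z))"
  using I \<psi>
proof (induction I arbitrary: \<psi> rule: finite_psubset_induct)
  case (psubset I)
  from psubset.prems obtain m where m: "\<And>z n z'. z \<in> PiE I (\<lambda>_. Z) \<Longrightarrow> z' \<in> PiE I (\<lambda>_. Z) \<Longrightarrow>
    (\<forall>i\<in>I. z' i \<inter> {..<m z n} = z i \<inter> {..<m z n}) \<Longrightarrow> \<psi> z' n \<le> \<psi> z n" by metis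
  define T where "T p = PiE I (\<lambda>_. Pow {..<p})" for p :: nat
  have finT: "finite (T p)" for p
    unfolding T_def by (rule finite_PiE) (use psubset.hyps in auto)
  have TZ: "t \<in> PiE I (\<lambda>_. Z)" if "t \<in> T p" for t p
    using that unfolding T_def Z_def by (auto simp: PiE_iff intro: finite_subset[of _ "{..<p}"])
  define M where "M p = (\<Sum>t\<in>T p. m t p)" for p
  define H where "H p = (\<Sum>t\<in>T p. \<psi> t p)" for p
  have H: "\<psi> z p \<le> H p" if z: "z \<in> PiE I (\<lambda>_. Z)" "\<And>i. i \<in> I \<Longrightarrow> p \<in> gaps (z i) M" for z p
  proof -
    \<comment> \<open>The truncations at \<open>p\<close> are finite sets, hence tuples in
      \<open>Z\<close>. If all \<open>z i\<close> avoid \<open>{p..<M p}\<close>, then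
      \<open>z\<close> agrees with its truncation up to the modulus \<open>m t p\<close>, and
      semicontinuity at \<open>t\<close> bounds the value.\<close>
    define t where "t = restrict (\<lambda>i. z i \<inter> {..<p}) I"
    have t: "t \<in> T p" unfolding T_def t_def by auto
    have "m t p \<le> M p" unfolding M_def using finT t by (intro member_le_sum) auto
    then have "z i \<inter> {..<m t p} = t i \<inter> {..<m t p}" if "i \<in> I" for i
      using z(2)[OF that] that unfolding t_def gaps_def by fastforce
    then have "\<psi> z p \<le> \<psi> t p" by (intro m[OF TZ[OF t] z(1)]) blast
    also have "\<dots> \<le> H p" unfolding H_def using finT t by (intro member_le_sum) auto
    finally show ?thesis .
  qed
  obtain i0 where i0: "i0 \<in> Field r" "\<And>j. (i0, j) \<in> r \<Longrightarrow> \<forall>\<^sub>F p in F. p \<in> gaps (s j) M"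
    using eventually_gaps by blast
  \<comment> \<open>The exceptional arguments, which need not avoid \<open>{p..<M p}\<close> for
    \<open>F\<close>-many \<open>p\<close>. There are fewer than \<open>r\<close> of them, so the
    bounds obtained by fixing one coordinate in \<open>R\<close> have a common
    \<open>F\<close>-bound.\<close>
  define R where "R = s ` underS r i0 \<union> Y"
  have R: "|R| <o r"
    unfolding R_def
    using card_of_underS[OF card_order i0(1)] card_of_image ordLeq_ordLess_trans Y
    by (intro card_of_Un_ordLess_infinite_Field card_order infinite_Field) blast+
  have gaps_R: "\<forall>\<^sub>F p in F. p \<in> gaps x M" if x: "x \<in> Z" "x \<notin> R" for x
  proof (cases "finite x")
    case True
    then obtain N where N: "\<forall>n\<in>x. n < N" using finite_nat_set_iff_bounded by blast
    have "\<forall>\<^sub>F p in F. N \<le> p" using F_sequentially eventually_ge_at_top by (rule filter_leD)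
    then show ?thesis by eventually_elim (use N in \<open>force simp: gaps_def\<close>)
  next
    case False
    then obtain j where j: "j \<in> Field r" "x = s j" using x unfolding Z_def R_def by blast
    then have "j \<notin> underS r i0" using x(2) unfolding R_def by blast
    then have "(i0, j) \<in> r"
      using Well_orderD(1,2)[of r j] j(1) i0(1) card_order unfolding underS_def card_order_on_def by blast
    then show ?thesis using i0(2) j(2) by blast
  qed
  have "\<exists>h. \<forall>z\<in>PiE (I - {l}) (\<lambda>_. Z). \<forall>\<^sub>F n in F. \<psi> (z(l := x)) n \<le> h n"
    if l: "l \<in> I" and x: "x \<in> Z" for l x
  proof -
    let ?I = "I - {l}"
    have upd: "z(l := x) \<in> PiE I (\<lambda>_. Z)" if "z \<in> PiE ?I (\<lambda>_. Z)" for z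
      using that l x by (auto simp: PiE_iff extensional_def)
    have "filter_bounded F ((\<lambda>z. \<psi> (z(l := x))) ` PiE ?I (\<lambda>_. Z))"
    proof (rule psubset.IH)
      show "?I \<subset> I" using l by blast
      fix z n assume z: "z \<in> PiE ?I (\<lambda>_. Z)"
      have "\<psi> (z'(l := x)) n \<le> \<psi> (z(l := x)) n" if z': "z' \<in> PiE ?I (\<lambda>_. Z)"
        "\<forall>i\<in>?I. z' i \<inter> {..<m (z(l := x)) n} = z i \<inter> {..<m (z(l := x)) n}" for z'
        by (rule m[OF upd[OF z] upd[OF z'(1)]]) (use z'(2) in simp)
      then show "\<exists>m. \<forall>z'\<in>PiE ?I (\<lambda>_. Z). (\<forall>i\<in>?I. z' i \<inter> {..<m} = z i \<inter> {..<m}) \<longrightarrow>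
          \<psi> (z'(l := x)) n \<le> \<psi> (z(l := x)) n" by blast
    qed
    then show ?thesis unfolding filter_bounded_def by blast
  qed
  then obtain h where h: "\<And>l x z. l \<in> I \<Longrightarrow> x \<in> Z \<Longrightarrow> z \<in> PiE (I - {l}) (\<lambda>_. Z) \<Longrightarrow>
    \<forall>\<^sub>F n in F. \<psi> (z(l := x)) n \<le> h l x n" by metis
  have RZ: "R \<subseteq> Z" unfolding R_def Z_def underS_def Field_def by blast
  have "|I \<times> R| <o r"
    by (intro card_of_Times_ordLess_Field card_of_finite_ordLess_Field card_order infinite_Field R psubset.hyps)
  then have "|(\<lambda>(l, x). h l x) ` (I \<times> R)| <o r"
    using card_of_image ordLeq_ordLess_trans by blast
  from filter_bounded_small[OF this] obtain g where g:
    "\<And>l x. l \<in> I \<Longrightarrow> x \<in> R \<Longrightarrow> \<forall>\<^sub>F n in F. h l x n \<le> g n"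
    unfolding filter_bounded_def by fastforce
  have max_bound: "\<forall>\<^sub>F n in F. \<psi> z n \<le> max (H n) (g n)" if z: "z \<in> PiE I (\<lambda>_. Z)" for z
  proof (cases "\<exists>l\<in>I. z l \<in> R")
    case True
    then obtain l where l: "l \<in> I" "z l \<in> R" by blast
    define y where "y = restrict z (I - {l})"
    have y: "y \<in> PiE (I - {l}) (\<lambda>_. Z)" unfolding y_def using z by auto
    have "z = y(l := z l)"
      unfolding y_def using z by (auto simp: fun_eq_iff PiE_def extensional_def)
    then have "\<forall>\<^sub>F n in F. \<psi> z n \<le> h l (z l) n" using h[OF l(1) _ y, of "z l"] l(2) RZ by auto
    with g[OF l] show ?thesis by eventually_elim simp
  next
    case False
    have "\<forall>\<^sub>F p in F. \<forall>i\<in>I. p \<in> gaps (z i) M"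
    proof (rule eventually_ball_finite[OF psubset.hyps(1)], rule ballI)
      fix i assume i: "i \<in> I"
      then show "\<forall>\<^sub>F p in F. p \<in> gaps (z i) M" using gaps_R[of "z i"] False PiE_mem[OF z i] by blast
    qed
    then show ?thesis
    proof eventually_elim
      case (elim p)
      then have "\<psi> z p \<le> H p" by (intro H[OF z]) blast
      then show ?case by simp
    qed
  qed
  show ?case
    unfolding filter_bounded_def
  proof (intro exI ballI)
    fix f assume "f \<in> \<psi> ` PiE I (\<lambda>_. Z)"
    then obtain z where "z \<in> PiE I (\<lambda>_. Z)" "f = \<psi> z" by blast
    then show "\<forall>\<^sub>F n in F. f n \<le> max (H n) (g n)" using max_bound by simp
  qed
qed

end

lemma openin_finite_power_agree:
  assumes U: "openin (finite_power (top_of_set (emb ` Z)) k) U"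
    and z: "restrict (\<lambda>i. emb (z i)) {..<k} \<in> U"
  shows "\<exists>m. \<forall>z'\<in>PiE {..<k} (\<lambda>_. Z). (\<forall>i\<in>{..<k}. z' i \<inter> {..<m} = z i \<inter> {..<m}) \<longrightarrow>
    restrict (\<lambda>i. emb (z' i)) {..<k} \<in> U"
proof -
  obtain V where V: "\<forall>i\<in>{..<k}. openin (top_of_set (emb ` Z)) (V i)"
    "restrict (\<lambda>i. emb (z i)) {..<k} \<in> PiE {..<k} V" "PiE {..<k} V \<subseteq> U"
    using U[unfolded finite_power_def openin_product_topology_alt, THEN bspec, OF z]
    by (elim exE conjE) (rule that)
  have "\<exists>m. \<forall>x\<in>Z. x \<inter> {..<m} = z i \<inter> {..<m} \<longrightarrow> emb x \<in> V i" if i: "i < k" for i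
  proof -
    have "emb (z i) \<in> V i" using V(2) i by (auto simp: PiE_iff)
    moreover have "openin (top_of_set (emb ` Z)) (V i)" using V(1) i by simp
    ultimately have "\<exists>e>0. \<forall>y\<in>emb ` Z. dist y (emb (z i)) < e \<longrightarrow> y \<in> V i"
      unfolding openin_euclidean_subtopology_iff by (elim conjE) (rule bspec)
    then obtain e where e: "0 < e" "\<And>y. y \<in> emb ` Z \<Longrightarrow> dist y (emb (z i)) < e \<Longrightarrow> y \<in> V i"
      by blast
    obtain m :: nat where m: "(1/2) ^ m < e / 2"
      using real_arch_pow_inv[of "e / 2" "1/2"] e(1) by auto
    have "emb x \<in> V i" if "x \<in> Z" "x \<inter> {..<m} = z i \<inter> {..<m}" for x
    proof -
      have "2 / 2 ^ m < e" using m by (simp add: power_one_over)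
      then show ?thesis using e(2)[of "emb x"] emb_dist[OF that(2)] that(1) by (simp add: dist_real_def)
    qed
    then show ?thesis by blast
  qed
  then obtain m where m: "\<And>i x. i < k \<Longrightarrow> x \<in> Z \<Longrightarrow> x \<inter> {..<m i} = z i \<inter> {..<m i} \<Longrightarrow> emb x \<in> V i"
    by metis
  define n where "n = (\<Sum>i<k. m i)"
  have n: "m i \<le> n" if "i < k" for i unfolding n_def using that by (intro member_le_sum) auto
  have "restrict (\<lambda>i. emb (z' i)) {..<k} \<in> U"
    if z': "z' \<in> PiE {..<k} (\<lambda>_. Z)" "\<forall>i\<in>{..<k}. z' i \<inter> {..<n} = z i \<inter> {..<n}" for z'
  proof -
    have "emb (z' i) \<in> V i" if i: "i < k" for i
    proof (rule m[OF i])
      show "z' i \<in> Z" using z'(1) i by auto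
      have cut: "x \<inter> {..<m i} = x \<inter> {..<n} \<inter> {..<m i}" for x :: "nat set"
        using n[OF i] by auto
      have "z' i \<inter> {..<n} = z i \<inter> {..<n}" using z'(2) i by simp
      then show "z' i \<inter> {..<m i} = z i \<inter> {..<m i}" using cut by metis
    qed
    then have "restrict (\<lambda>i. emb (z' i)) {..<k} \<in> PiE {..<k} V" by auto
    then show ?thesis using V(3) by blast
  qed
  then show ?thesis by blast
qed

lemma (in gap_scale) cover_small_power:
  assumes Y: "|Y| <o r"
  defines "Z \<equiv> s ` Field r \<union> Y \<union> Collect finite"
  shows "cover_small (filter_bounded F) (finite_power (top_of_set (emb ` Z)) k)"
  unfolding cover_small_def
proof (intro allI impI, elim conjE)
  let ?P = "finite_power (top_of_set (emb ` Z)) k"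
  fix U :: "nat \<Rightarrow> nat \<Rightarrow> (nat \<Rightarrow> real) set"
  assume U: "\<forall>n j. openin ?P (U n j)" "\<forall>n. topspace ?P \<subseteq> (\<Union>j. U n j)"
  let ?e = "\<lambda>z. restrict (\<lambda>i. emb (z i)) {..<k}"
  define \<psi> where "\<psi> z n = (LEAST j. ?e z \<in> U n j)" for z n
  have e: "?e z \<in> topspace ?P" if "z \<in> PiE {..<k} (\<lambda>_. Z)" for z
    using that unfolding topspace_finite_power by auto
  have "filter_bounded F (\<psi> ` PiE {..<k} (\<lambda>_. Z))"
    unfolding Z_def
  proof (rule filter_bounded_power[OF Y], fold Z_def)
    show "finite {..<k}" by simp
    fix z n assume z: "z \<in> PiE {..<k} (\<lambda>_. Z)"
    have "\<exists>j. ?e z \<in> U n j" using e[OF z] U(2) by blast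
    then have "?e z \<in> U n (\<psi> z n)" unfolding \<psi>_def by (rule LeastI_ex)
    from openin_finite_power_agree[OF _ this] U(1)
    have "\<exists>m. \<forall>z'\<in>PiE {..<k} (\<lambda>_. Z). (\<forall>i\<in>{..<k}. z' i \<inter> {..<m} = z i \<inter> {..<m}) \<longrightarrow>
      ?e z' \<in> U n (\<psi> z n)" by simp
    then obtain m where m: "\<forall>z'\<in>PiE {..<k} (\<lambda>_. Z). (\<forall>i\<in>{..<k}. z' i \<inter> {..<m} = z i \<inter> {..<m}) \<longrightarrow>
      ?e z' \<in> U n (\<psi> z n)" by (elim exE) (rule that)
    show "\<exists>m. \<forall>z'\<in>PiE {..<k} (\<lambda>_. Z).
        (\<forall>i\<in>{..<k}. z' i \<inter> {..<m} = z i \<inter> {..<m}) \<longrightarrow> \<psi> z' n \<le> \<psi> z n"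
    proof (intro exI ballI impI)
      fix z' assume "z' \<in> PiE {..<k} (\<lambda>_. Z)" "\<forall>i\<in>{..<k}. z' i \<inter> {..<m} = z i \<inter> {..<m}"
      from m[THEN bspec, THEN mp, OF this] show "\<psi> z' n \<le> \<psi> z n"
        unfolding \<psi>_def[of z'] by (rule Least_le)
    qed
  qed
  moreover have "(\<lambda>y n. LEAST j. y \<in> U n j) ` topspace ?P = \<psi> ` PiE {..<k} (\<lambda>_. Z)"
  proof -
    have "topspace ?P = ?e ` PiE {..<k} (\<lambda>_. Z)"
    proof (intro equalityI subsetI)
      fix y assume "y \<in> topspace ?P"
      then have y: "y \<in> PiE {..<k} (\<lambda>_. emb ` Z)" unfolding topspace_finite_power .
      define z where "z = restrict (\<lambda>i. inv_into Z emb (y i)) {..<k}"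
      have "z \<in> PiE {..<k} (\<lambda>_. Z)" "?e z = y"
        unfolding z_def using y
        by (simp_all add: PiE_iff inv_into_into f_inv_into_f fun_eq_iff extensional_def)
      then show "y \<in> ?e ` PiE {..<k} (\<lambda>_. Z)" by blast
    qed (use e in blast)
    then show ?thesis by (simp only: image_image \<psi>_def[abs_def])
  qed
  ultimately show "filter_bounded F ((\<lambda>y n. LEAST j. y \<in> U n j) ` topspace ?P)" by simp
qed

section \<open>The Hurewicz property\<close>

text \<open>The set of numbers \<^term>\<open>emb e\<close> with \<^term>\<open>e\<close> cofinite is disjoint from the field, so the
  inverse distances to its points are finite on the field. The floors, for a single such number
  \<^term>\<open>emb UNIV\<close>, turn them into continuous functions with values in the natural numbers.\<close>
lemma not_Hurewicz_rat_adjoin: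
  assumes coinf: "\<And>z. z \<in> Z \<Longrightarrow> infinite (- z)"
    and unb: "\<And>M. \<exists>z\<in>Z. infinite (gaps (- z) M)"
  shows "\<not> Hurewicz_property (top_of_set (rat_adjoin (emb ` Z)))"
proof
  let ?Q = "rat_adjoin (emb ` Z)"
  assume Hur: "Hurewicz_property (top_of_set ?Q)"
  define c where "c = emb UNIV"
  have notin: "emb e \<notin> ?Q" if "finite (- e)" for e
    by (rule emb_notin_rat_adjoin) (use coinf that in blast)
  \<comment> \<open>The jumps of this floor lie at \<open>c\<close> plus rational numbers, outside
    the field because \<open>c\<close> is. So \<open>fl i\<close> is locally constant on the
    field.\<close>
  define fl where "fl i y = \<lfloor>real i * (y - c)\<rfloor>" for i y
  define P where "P y p j \<longleftrightarrow> (\<forall>t\<in>Pow {..<p}. \<exists>i\<le>j. 2 \<le> \<bar>fl i y - fl i (emb (t \<union> {p..}))\<bar>)"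
    for y and p j :: nat
  define h where "h y p = (LEAST j. P y p j)" for y p
  have P_ex: "\<exists>j. P y p j" if y: "y \<in> ?Q" for y p
  proof -
    have "\<exists>i. 2 \<le> \<bar>fl i y - fl i (emb (t \<union> {p..}))\<bar>" if "t \<in> Pow {..<p}" for t
    proof -
      let ?e = "emb (t \<union> {p..})"
      have "?e \<notin> ?Q" by (rule notin) (rule finite_subset[of _ "{..<p}"], auto)
      then have "0 < \<bar>y - ?e\<bar>" using y by auto
      \<comment> \<open>Floors change a difference by less than 1: more than 3 leaves at least 2
        between the floors, and conversely 2 between the floors gives more than 1 in
        \<open>h_dist\<close>.\<close>
      then obtain i :: nat where i: "3 < real i * \<bar>y - ?e\<bar>" using ex_less_of_nat_mult by blast
      have "real i * (y - c) - real i * (?e - c) = real i * (y - ?e)" by (simp add: algebra_simps)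
      then have "3 < \<bar>real i * (y - c) - real i * (?e - c)\<bar>" using i by (simp add: abs_mult)
      then have "2 \<le> \<bar>fl i y - fl i ?e\<bar>" unfolding fl_def by linarith
      then show ?thesis by blast
    qed
    then obtain i where i: "\<And>t. t \<in> Pow {..<p} \<Longrightarrow> 2 \<le> \<bar>fl (i t) y - fl (i t) (emb (t \<union> {p..}))\<bar>"
      by metis
    have "i t \<le> (\<Sum>t\<in>Pow {..<p}. i t)" if "t \<in> Pow {..<p}" for t
      using that by (intro member_le_sum) auto
    then show ?thesis unfolding P_def using i by blast
  qed
  have h_dist: "1 < real (h y p) * \<bar>y - emb (t \<union> {p..})\<bar>" if y: "y \<in> ?Q" and t: "t \<subseteq> {..<p}" for y p t
  proof -
    let ?e = "emb (t \<union> {p..})"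
    have "P y p (h y p)" unfolding h_def using P_ex[OF y] by (rule LeastI_ex)
    then obtain i where i: "i \<le> h y p" "2 \<le> \<bar>fl i y - fl i ?e\<bar>" unfolding P_def using t by blast
    have "1 < \<bar>real i * (y - c) - real i * (?e - c)\<bar>" using i(2) unfolding fl_def by linarith
    also have "real i * (y - c) - real i * (?e - c) = real i * (y - ?e)" by (simp add: algebra_simps)
    also have "\<bar>\<dots>\<bar> = real i * \<bar>y - ?e\<bar>" by (simp add: abs_mult)
    also have "\<dots> \<le> real (h y p) * \<bar>y - ?e\<bar>" using i(1) by (intro mult_right_mono) auto
    finally show ?thesis .
  qed
  have fl_open: "openin (top_of_set ?Q) {y \<in> ?Q. fl i y = v}" for i v
  proof (cases "i = 0")
    case True
    then have "{y \<in> ?Q. fl i y = v} = (if v = 0 then ?Q else {})" unfolding fl_def by auto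
    then show ?thesis by simp
  next
    case False
    have ne: "real i * (y - c) \<noteq> of_int v" if y: "y \<in> ?Q" for y
    proof
      assume "real i * (y - c) = of_int v"
      then have "c = y + of_int (- v) / of_nat i" using False by (simp add: field_simps)
      also have "\<dots> \<in> ?Q"
        by (intro rat_adjoin_closed(1) y rat_adjoin_closed(4) Rats_divide Rats_of_int Rats_of_nat)
      finally show False using notin[of UNIV] unfolding c_def by simp
    qed
    have "{y \<in> ?Q. fl i y = v} = ?Q \<inter> (\<lambda>y. real i * (y - c)) -` {of_int v<..<of_int v + 1}"
    proof -
      have "\<lfloor>w\<rfloor> = v \<longleftrightarrow> w \<in> {of_int v<..<of_int v + 1}" if "w \<noteq> of_int v" for w :: real
        using that by (auto simp: floor_eq_iff)
      from this[OF ne] show ?thesis unfolding fl_def by blast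
    qed
    also have "openin (top_of_set ?Q) \<dots>"
      by (intro openin_open_Int open_vimage continuous_intros open_greaterThanLessThan)
    finally show ?thesis .
  qed
  have h_open: "openin (top_of_set ?Q) {y \<in> ?Q. h y p = j}" for p j
  proof (subst openin_subopen, intro ballI)
    fix y0 assume "y0 \<in> {y \<in> ?Q. h y p = j}"
    then have y0: "y0 \<in> ?Q" "h y0 p = j" by simp_all
    \<comment> \<open>Whether \<open>P y p j'\<close> holds for \<open>j' \<le> j\<close> depends
      only on the floors up to \<open>j\<close>, so the least such index is constant on this
      neighbourhood.\<close>
    define T where "T = (\<Inter>i\<in>{..j}. {y \<in> ?Q. fl i y = fl i y0})"
    have "openin (top_of_set ?Q) T" unfolding T_def using fl_open by (intro openin_Inter) auto
    moreover have "y0 \<in> T" unfolding T_def using y0 by simp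
    moreover have "T \<subseteq> {y \<in> ?Q. h y p = j}"
    proof
      fix y assume y: "y \<in> T"
      then have eq: "fl i y = fl i y0" if "i \<le> j" for i using that unfolding T_def by blast
      have P_eq: "P y p j' \<longleftrightarrow> P y0 p j'" if "j' \<le> j" for j'
        unfolding P_def using eq that by (metis order_trans)
      have "P y0 p j" using LeastI_ex[OF P_ex[OF y0(1)]] y0(2) unfolding h_def by blast
      then have Pj: "P y p j" using P_eq by simp
      have "h y p = j"
        unfolding h_def
      proof (rule Least_equality)
        show "P y p j" by (rule Pj)
        fix j' assume j': "P y p j'"
        show "j \<le> j'"
        proof (rule ccontr)
          assume "\<not> j \<le> j'"
          then have "j' < j" "P y0 p j'" using P_eq[of j'] j' by simp_all
          then show False using y0(2) not_less_Least unfolding h_def by blast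
        qed
      qed
      moreover have "y \<in> ?Q" using y unfolding T_def by blast
      ultimately show "y \<in> {y \<in> ?Q. h y p = j}" by simp
    qed
    ultimately show "\<exists>T. openin (top_of_set ?Q) T \<and> y0 \<in> T \<and> T \<subseteq> {y \<in> ?Q. h y p = j}" by blast
  qed
  have "continuous_map (top_of_set ?Q) (discrete_topology UNIV) (\<lambda>y. h y p)" for p
    unfolding continuous_map_def
  proof (intro conjI allI impI)
    fix U :: "nat set"
    have eq: "{y \<in> topspace (top_of_set ?Q). h y p \<in> U} = (\<Union>j\<in>U. {y \<in> ?Q. h y p = j})" by auto
    show "openin (top_of_set ?Q) {y \<in> topspace (top_of_set ?Q). h y p \<in> U}"
      unfolding eq by (rule openin_Union) (elim imageE, simp only: h_open)
  qed simp
  then have "continuous_map (top_of_set ?Q) baire_space h"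
    unfolding baire_space_def continuous_map_componentwise_UNIV by simp
  then have "le_star_bounded (h ` ?Q)"
    using Hur unfolding Hurewicz_property_def by fastforce
  then obtain g where g: "\<And>y. y \<in> ?Q \<Longrightarrow> h y \<le>\<^sup>* g" unfolding le_star_bounded_def by blast
  have "\<exists>m. 2 / 2 ^ m < 1 / (real (g p) + 1)" for p
  proof -
    define e where "e = 1 / (real (g p) + 1)"
    have "0 < e" unfolding e_def by simp
    then obtain m where "(1/2) ^ m < e / 2" using real_arch_pow_inv[of "e / 2" "1/2"] by auto
    then have "2 / 2 ^ m < e" by (simp add: power_one_over)
    then show ?thesis unfolding e_def by blast
  qed
  \<comment> \<open>If \<open>z\<close> contains \<open>{p..<M p}\<close>, then \<open>emb z\<close>
    is so close to the number of the cofinite set that agrees with \<open>z\<close> below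
    \<open>p\<close> that \<open>h (emb z) p\<close> exceeds \<open>g p\<close>.\<close>
  then obtain M where M: "\<And>p. 2 / 2 ^ M p < 1 / (real (g p) + 1)" by metis
  obtain z where z: "z \<in> Z" "infinite (gaps (- z) M)" using unb by blast
  have zQ: "emb z \<in> ?Q" using z(1) by (intro rat_adjoin_closed(5)) blast
  have "infinite (gaps (- z) M - {p. \<not> h (emb z) p \<le> g p})"
    using g[OF zQ] z(2) unfolding le_star_def by (rule Diff_infinite_finite)
  then obtain p where p: "p \<in> gaps (- z) M" "h (emb z) p \<le> g p"
    using infinite_imp_nonempty by blast
  let ?t = "z \<inter> {..<p}"
  have sub: "{p..<M p} \<subseteq> z" using p(1) unfolding gaps_def by blast
  have agree: "z \<inter> {..<M p} = (?t \<union> {p..}) \<inter> {..<M p}"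
  proof (rule Set.set_eqI)
    fix x
    show "x \<in> z \<inter> {..<M p} \<longleftrightarrow> x \<in> (?t \<union> {p..}) \<inter> {..<M p}"
      using subsetD[OF sub, of x] by (cases "x < p") auto
  qed
  have "\<bar>emb z - emb (?t \<union> {p..})\<bar> < 1 / (real (g p) + 1)"
    using emb_dist[OF agree] M[of p] by (rule le_less_trans)
  then have "real (g p) * \<bar>emb z - emb (?t \<union> {p..})\<bar> \<le> real (g p) * (1 / (real (g p) + 1))"
    by (intro mult_left_mono) auto
  also have "\<dots> \<le> 1" by (simp add: field_simps)
  finally have "real (g p) * \<bar>emb z - emb (?t \<union> {p..})\<bar> \<le> 1" .
  moreover have "1 < real (h (emb z) p) * \<bar>emb z - emb (?t \<union> {p..})\<bar>" by (rule h_dist[OF zQ]) simp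
  moreover have "real (h (emb z) p) * \<bar>emb z - emb (?t \<union> {p..})\<bar> \<le> real (g p) * \<bar>emb z - emb (?t \<union> {p..})\<bar>"
    using p(2) by (intro mult_right_mono) auto
  ultimately show False by linarith
qed

text \<open>If \<open>g\<close> exceeds a monotone majorant of \<open>M\<close> at \<open>n\<close>,
  with \<open>a g k \<le> n < a g (k + 1)\<close>, then \<open>M (a g k) \<le> a g (k + 2)\<close>.
  So infinitely many intervals \<open>{a g k..<a g (k + 2)}\<close> are long enough for
  \<open>M\<close>, and infinitely many of these have the same residue of \<open>k\<close>.\<close>

lemma exists_infinite_full_intervals:
  assumes A: "\<not> le_star_bounded A" and r: "Card_order r" "infinite (Field r)"
  shows "\<exists>Y. ( |A| <o r \<longrightarrow> |Y| <o r) \<and> ( |A| \<le>o r \<longrightarrow> |Y| \<le>o r)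
    \<and> (\<forall>y\<in>Y. infinite (- y)) \<and> (\<forall>M. \<exists>y\<in>Y. infinite (gaps (- y) M))"
proof -
  have "\<exists>g'. mono g' \<and> (\<forall>n. n + 2 \<le> g' n) \<and> (\<forall>n. g n \<le> g' n)" for g :: "nat \<Rightarrow> nat"
    using mono_majorant[of g] by metis
  then obtain G where G: "\<And>g. mono (G g)" "\<And>g n. n + 2 \<le> G g n" "\<And>g n. g n \<le> (G g n :: nat)"
    by metis
  define a where "a g k = ((G g) ^^ k) 0" for g k
  have aS: "a g (Suc k) = G g (a g k)" and a0: "a g 0 = 0" for g k unfolding a_def by simp_all
  have sm: "strict_mono (a g)" for g
    unfolding strict_mono_Suc_iff aS using G(2) by (metis add_2_eq_Suc' Suc_le_lessD less_imp_le_nat Suc_leD)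
  \<comment> \<open>Modulus 3 leaves one of every three consecutive orbit intervals empty, which
    keeps the set coinfinite.\<close>
  define y where "y j g = (\<Union>k\<in>{k. k mod 3 = j}. {a g k..<a g (k + 2)})" for j :: nat and g
  define Y where "Y = (\<lambda>(j, g). y j g) ` ({..<3} \<times> A)"
  have three: "|{..<3::nat}| <o r" by (rule card_of_finite_ordLess_Field[OF r]) simp
  have "|Y| <o r" if "|A| <o r"
    unfolding Y_def using card_of_Times_ordLess_Field[OF r three that] card_of_image ordLeq_ordLess_trans by blast
  moreover have "|Y| \<le>o r" if "|A| \<le>o r"
    unfolding Y_def
    using card_of_Times_ordLeq_infinite_Field[OF r(2) ordLess_imp_ordLeq[OF three] that r(1)] card_of_image ordLeq_transitive
    by blast
  moreover have "infinite (- y j g)" for j g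
  proof -
    have "a g (3 * k + j + 2) \<notin> y j g" for k
    proof
      assume "a g (3 * k + j + 2) \<in> y j g"
      then obtain l where l: "l mod 3 = j" "a g l \<le> a g (3 * k + j + 2)" "a g (3 * k + j + 2) < a g (l + 2)"
        unfolding y_def by auto
      then have "l \<le> 3 * k + j + 2" "3 * k + j + 2 < l + 2"
        using strict_mono_less_eq[OF sm] strict_mono_less[OF sm] by blast+
      moreover have "l = 3 * (l div 3) + j" using l(1) mult_div_mod_eq[of 3 l] by simp
      ultimately have "l div 3 < k + 1" "k < l div 3" by linarith+
      then show False by simp
    qed
    then have "range (\<lambda>k. a g (3 * k + j + 2)) \<subseteq> - y j g" by blast
    moreover have "inj (\<lambda>k. a g (3 * k + j + 2))"
      using strict_mono_eq[OF sm[of g]] by (auto simp: inj_on_def)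
    ultimately show ?thesis using range_inj_infinite finite_subset by metis
  qed
  then have "\<forall>y\<in>Y. infinite (- y)" unfolding Y_def by auto
  moreover have "\<exists>y\<in>Y. infinite (gaps (- y) M)" for M
  proof -
    obtain M' where M': "mono M'" "\<And>n. M n \<le> M' n" using mono_majorant[of M] by metis
    obtain g where g: "g \<in> A" "\<not> g \<le>\<^sup>* M'" using A unfolding le_star_bounded_def by blast
    have "\<exists>k\<ge>N. M (a g k) \<le> a g (k + 2)" for N
    proof -
      obtain n where n: "a g N \<le> n" "M' n < g n"
        using g(2) unfolding le_star_def infinite_nat_iff_unbounded_le by (auto simp: not_le)
      obtain k where k: "a g k \<le> n" "n < a g (Suc k)"
        using strict_mono_bracket[OF sm[of g], of n] a0 by auto
      have "a g N < a g (Suc k)" using n(1) k(2) by simp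
      then have "N \<le> k" using strict_mono_less[OF sm[of g]] by simp
      have "M (a g k) \<le> M' n" using M'(2)[of "a g k"] monoD[OF M'(1) k(1)] by simp
      also have "\<dots> \<le> G g (a g (Suc k))"
        using n(2) G(3)[of g n] monoD[OF G(1)[of g], of n "a g (Suc k)"] k(2) by simp
      finally have "M (a g k) \<le> a g (k + 2)" using aS[of g "Suc k"] by simp
      then show ?thesis using \<open>N \<le> k\<close> by blast
    qed
    then have inf: "infinite {k. M (a g k) \<le> a g (k + 2)}"
      unfolding infinite_nat_iff_unbounded_le by blast
    have "{k. M (a g k) \<le> a g (k + 2)} = (\<Union>j\<in>{..<3}. {k. M (a g k) \<le> a g (k + 2) \<and> k mod 3 = j})"
      by auto
    then obtain j where j: "j < 3" "infinite {k. M (a g k) \<le> a g (k + 2) \<and> k mod 3 = j}"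
      using inf by auto
    have "a g ` {k. M (a g k) \<le> a g (k + 2) \<and> k mod 3 = j} \<subseteq> gaps (- y j g) M"
    proof (rule image_subsetI)
      fix k assume "k \<in> {k. M (a g k) \<le> a g (k + 2) \<and> k mod 3 = j}"
      then have "{a g k..<M (a g k)} \<subseteq> {a g k..<a g (k + 2)}" "{a g k..<a g (k + 2)} \<subseteq> y j g"
        unfolding y_def by auto
      then show "a g k \<in> gaps (- y j g) M" unfolding gaps_def by blast
    qed
    moreover have "infinite (a g ` {k. M (a g k) \<le> a g (k + 2) \<and> k mod 3 = j})"
      using j(2) finite_imageD[OF _ inj_on_subset[OF strict_mono_imp_inj_on[OF sm[of g]] subset_UNIV]]
      by blast
    ultimately have "infinite (gaps (- y j g) M)" by (rule infinite_super)
    moreover have "y j g \<in> Y" unfolding Y_def using j(1) g(1) by (intro image_eqI[of _ _ "(j, g)"]) simp_all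
    ultimately show ?thesis by (rule bexI)
  qed
  ultimately show ?thesis by blast
qed

lemma cover_small_card:
  assumes r: "Card_order r" "infinite (Field r)" and S: "|S| \<le>o r"
  shows "cover_small (\<lambda>A. |A| \<le>o r) (finite_power (top_of_set S) k)"
proof -
  have "inj_on (\<lambda>x. map x [0..<k]) (PiE {..<k} (\<lambda>_. S))"
    by (intro inj_onI PiE_ext) (auto simp: map_eq_conv)
  moreover have "(\<lambda>x. map x [0..<k]) ` PiE {..<k} (\<lambda>_. S) \<subseteq> lists S"
  proof (rule image_subsetI)
    fix x assume "x \<in> PiE {..<k} (\<lambda>_. S)"
    then have "x i \<in> S" if "i < k" for i using that by auto
    then show "map x [0..<k] \<in> lists S" unfolding lists_eq_set by auto
  qed
  ultimately have "|PiE {..<k} (\<lambda>_. S)| \<le>o |lists S|"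
    by (intro card_of_ordLeq[THEN iffD1] exI conjI)
  then have "|topspace (finite_power (top_of_set S) k)| \<le>o r"
    unfolding topspace_finite_power using card_of_lists_ordLeq[OF r S] by (rule ordLeq_transitive)
  then show ?thesis
    unfolding cover_small_def using card_of_image ordLeq_transitive by blast
qed

theorem corollary6p4:
  shows "\<exists>S :: real set.
    |S| =o cofinality dominating_number \<and>
    (\<forall>k. Menger_property (finite_power (top_of_set (rat_adjoin S)) k)) \<and>
    \<not> Hurewicz_property (top_of_set (rat_adjoin S))"
proof -
  let ?d = dominating_number
  obtain r :: "(nat \<Rightarrow> nat) rel" and s and F :: "nat filter" and A where r: "Card_order r" "infinite (Field r)"
      "r = cofinality ?d" "r \<le>o ?d"
    and bound: "\<forall>K. K \<subseteq> Field r \<longrightarrow> |K| <o r \<longrightarrow> (\<exists>i\<in>Field r. \<forall>k\<in>K. (k, i) \<in> r)"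
    and F: "F \<noteq> bot" "F \<le> sequentially"
    and s: "\<forall>i\<in>Field r. infinite (s i) \<and> infinite (- s i)"
    and s_gaps: "\<forall>M. \<exists>i\<in>Field r. \<forall>j. (i, j) \<in> r \<longrightarrow> (\<forall>\<^sub>F p in F. p \<in> gaps (s j) M)"
    and s_full: "(\<forall>A. |A| <o ?d \<longrightarrow> le_star_bounded A) \<longrightarrow> (\<forall>M. \<exists>i\<in>Field r. infinite (gaps (- s i) M))"
    and A: "|A| \<le>o r" "\<not> le_star_bounded A"
    using gap_family by (elim exE conjE) (rule that)
  interpret gap_scale r s F
    by unfold_locales (use r(1,2) bound F s s_gaps in simp_all)
  \<comment> \<open>The disjunction records which argument will give Menger's property:
    \<open>F\<close>-boundedness if \<open>Y\<close> is small, cardinality if cf(\<dd>) <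
    \<dd>.\<close>
  have "\<exists>Y. |Y| \<le>o r \<and> ( |Y| <o r \<or> r <o ?d) \<and> (\<forall>y\<in>Y. infinite (- y))
      \<and> (\<forall>M. \<exists>z\<in>s ` Field r \<union> Y. infinite (gaps (- z) M))"
  proof (cases "r <o ?d")
    case True
    from exists_infinite_full_intervals[OF A(2) r(1,2)] obtain Y where
      "|Y| \<le>o r" "\<forall>y\<in>Y. infinite (- y)" "\<forall>M. \<exists>y\<in>Y. infinite (gaps (- y) M)"
      using A(1) by metis
    then show ?thesis using True by blast
  next
    case False
    then have rd: "?d =o r"
      using r(4) ordLeq_iff_ordLess_or_ordIso ordIso_symmetric by blast
    show ?thesis
    proof (cases "\<forall>A. |A| <o ?d \<longrightarrow> le_star_bounded A")
      case True
      have "|{} :: nat set set| <o r" by (rule card_of_finite_ordLess_Field[OF r(1,2)]) simp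
      moreover have "\<forall>M. \<exists>z\<in>s ` Field r \<union> {}. infinite (gaps (- z) M)" using s_full True by blast
      ultimately show ?thesis by (intro exI[of _ "{}"] conjI disjI1 ordLess_imp_ordLeq) simp_all
    next
      case False
      then obtain A where A: "|A| <o ?d" "\<not> le_star_bounded A" by blast
      have "|A| <o r" using A(1) rd by (rule ordLess_ordIso_trans)
      with exists_infinite_full_intervals[OF A(2) r(1,2)] obtain Y where
        Y: "|Y| <o r" "\<forall>y\<in>Y. infinite (- y)" "\<forall>M. \<exists>y\<in>Y. infinite (gaps (- y) M)" by metis
      have "\<forall>M. \<exists>z\<in>s ` Field r \<union> Y. infinite (gaps (- z) M)" using Y(3) by blast
      with Y(1,2) show ?thesis by (intro exI[of _ Y] conjI disjI1 ordLess_imp_ordLeq)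
    qed
  qed
  then obtain Y where Y: "|Y| \<le>o r" "|Y| <o r \<or> r <o ?d" "\<forall>y\<in>Y. infinite (- y)"
    "\<forall>M. \<exists>z\<in>s ` Field r \<union> Y. infinite (gaps (- z) M)" by blast
  define Z where "Z = s ` Field r \<union> Y \<union> Collect finite"
  have coinf: "infinite (- z)" if "z \<in> Z" for z
  proof (cases "finite z")
    case True
    then show ?thesis by simp
  next
    case False
    then show ?thesis using that s Y(3) unfolding Z_def by blast
  qed
  have "|emb ` Z| =o |Z|"
    using inj_on_subset[OF inj_emb subset_UNIV, THEN inj_on_imp_bij_betw]
    by (rule ordIso_symmetric[OF card_of_ordIsoI])
  moreover have "|Z| =o r"
  proof -
    have "countable (Collect finite :: nat set set)" by (rule countable_Collect_finite)
    then have "|Collect finite :: nat set set| \<le>o r" by (rule countable_ordLeq) (rule r)+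
    moreover have sr: "|s ` Field r| \<le>o r" "r \<le>o |s ` Field r|"
      using card_of_range ordIso_imp_ordLeq ordIso_symmetric by blast+
    ultimately have "|Z| \<le>o r"
      unfolding Z_def using Y(1) by (intro card_of_Un_ordLeq_infinite_Field r(1,2))
    moreover have "s ` Field r \<subseteq> Z" unfolding Z_def by blast
    then have "r \<le>o |Z|" using sr(2) card_of_mono1 ordLeq_transitive by blast
    ultimately show ?thesis by (simp add: ordIso_iff_ordLeq)
  qed
  ultimately have card: "|emb ` Z| =o r" by (rule ordIso_transitive)
  have ne: "emb ` Z \<noteq> {}" unfolding Z_def by blast
  have "Menger_property (finite_power (top_of_set (rat_adjoin (emb ` Z))) k)" for k
    using Y(2)
  proof
    assume Y: "|Y| <o r"
    show ?thesis
    proof (rule cover_small_Menger[OF cover_small_rat_adjoin[OF _ ne]])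
      show "filter_bounded F (\<Union>\<A>)" if "countable \<A>" "\<And>A. A \<in> \<A> \<Longrightarrow> filter_bounded F A" for \<A>
        using filter_bounded_Union[OF F(2) that] .
      show "cover_small (filter_bounded F) (finite_power (top_of_set (emb ` Z)) m)" for m
        unfolding Z_def by (rule cover_small_power[OF Y])
      show "\<not> dominating A" if "filter_bounded F A" for A
        using filter_bounded_not_dominating[OF F that] .
    qed
  next
    assume less: "r <o ?d"
    show ?thesis
    proof (rule cover_small_Menger[OF cover_small_rat_adjoin[OF _ ne]])
      show "|\<Union>\<A>| \<le>o r" if \<A>: "countable \<A>" "\<And>A. A \<in> \<A> \<Longrightarrow> |A| \<le>o r" for \<A> :: "(nat \<Rightarrow> nat) set set"
      proof -
        have "|\<A>| \<le>o r" using \<A>(1) by (rule countable_ordLeq) (rule r)+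
        then have "|\<Union>A\<in>\<A>. A| \<le>o r"
          by (intro card_of_UNION_ordLeq_infinite_Field r(1,2)) (use \<A>(2) in auto)
        then show ?thesis by simp
      qed
      show "cover_small (\<lambda>A. |A| \<le>o r) (finite_power (top_of_set (emb ` Z)) m)" for m
        using card ordIso_iff_ordLeq by (intro cover_small_card r(1,2)) blast
      show "\<not> dominating A" if "|A| \<le>o r" for A
        using ordLess_not_dominating ordLeq_ordLess_trans[OF that less] by blast
    qed
  qed
  moreover have "\<not> Hurewicz_property (top_of_set (rat_adjoin (emb ` Z)))"
  proof (rule not_Hurewicz_rat_adjoin[OF coinf])
    fix M
    obtain z where "z \<in> s ` Field r \<union> Y" "infinite (gaps (- z) M)" using Y(4) by blast
    then show "\<exists>z\<in>Z. infinite (gaps (- z) M)" unfolding Z_def by blast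
  qed
  ultimately show ?thesis using card r(3) by blast
qed

end
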